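(* Let $C$ be a chain coalgebra over a field $K$. Then $C$ is a left and right finite Rat-splitting coalgebra.
   Context: $C$ is a coalgebra over a field $K$ with comultiplication $\Delta(c)=c_1\otimes c_2$ and counit $\varepsilon$; $C^*=\mathrm{Hom}_K(C,K)$ is the dual algebra with convolution product $(fg)(c)=f(c_1)g(c_2)$. $C$ is a chain coalgebra if any two left subcomodules of $C$ are comparable under inclusion (this is equivalent to the same condition for right subcomodules). Right $C$-comodules are regarded as left $C^*$-modules via $f\cdot m=f(m_1)m_0$, and left $C$-comodules as right $C^*$-modules analogously; modules arising in this way are called rational. For a left (right) $C^*$-module $M$, $\mathrm{Rat}(M)$ is the sum of all rational submodules of $M$; equivalently, $m\in\mathrm{Rat}(M)$ iff there are finitely many $m_i\in M$, $c_i\in C$ with $f\cdot m=\sum_i f(c_i)m_i$ (respectively $m\cdot f=\sum_i f(c_i)m_i$) for all $f\in C^*$. $C$ is called left (right) finite Rat-splitting if $\mathrm{Rat}(M)$ is a direct summand of $M$ for every finitely generated left (right) $C^*$-module $M$. *)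

theory Defs
  imports Complex_Main
begin

text \<open>
  Let \<open>A\<close> and \<open>B\<close> be \<open>K\<close>-subspaces of ambient vector spaces with scalar multiplications \<open>sa\<close> and
  \<open>sb\<close>. The list \<open>[(a1, b1), ..., (an, bn)]\<close> over \<open>A \<times> B\<close> stands for the element
  \<open>a1 \<otimes> b1 + ... + an \<otimes> bn\<close> of \<open>A \<otimes> B\<close>, and \<open>tensor_eq\<close> is equality in \<open>A \<otimes> B\<close>: the tensor product
  is presented as the commutative monoid generated by the pairs \<open>(a, b)\<close> subject to the bilinearity
  relations. The relation \<open>zero\<close> makes it a group (the negative of \<open>(a, b)\<close> is \<open>(- a, b)\<close>), so this
  is the usual quotient of the free abelian group on \<open>A \<times> B\<close>; the scalar \<open>k\<close> acts by
  \<open>(a, b) \<mapsto> (sa k a, b)\<close>.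
\<close>

inductive tensor_eq ::
    "('k \<Rightarrow> 'a::ab_group_add \<Rightarrow> 'a) \<Rightarrow> ('k \<Rightarrow> 'b::ab_group_add \<Rightarrow> 'b) \<Rightarrow> 'a set \<Rightarrow> 'b set \<Rightarrow>
      ('a \<times> 'b) list \<Rightarrow> ('a \<times> 'b) list \<Rightarrow> bool"
  for sa :: "'k \<Rightarrow> 'a::ab_group_add \<Rightarrow> 'a" and sb :: "'k \<Rightarrow> 'b::ab_group_add \<Rightarrow> 'b"
    and A :: "'a set" and B :: "'b set"
where
  refl: "set xs \<subseteq> A \<times> B \<Longrightarrow> tensor_eq sa sb A B xs xs"
| sym: "tensor_eq sa sb A B xs ys \<Longrightarrow> tensor_eq sa sb A B ys xs"
| trans: "tensor_eq sa sb A B xs ys \<Longrightarrow> tensor_eq sa sb A B ys zs \<Longrightarrow> tensor_eq sa sb A B xs zs"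
| append: "tensor_eq sa sb A B xs xs' \<Longrightarrow> tensor_eq sa sb A B ys ys' \<Longrightarrow>
    tensor_eq sa sb A B (xs @ ys) (xs' @ ys')"
| commute: "set xs \<subseteq> A \<times> B \<Longrightarrow> set ys \<subseteq> A \<times> B \<Longrightarrow> tensor_eq sa sb A B (xs @ ys) (ys @ xs)"
| add_left: "a \<in> A \<Longrightarrow> a' \<in> A \<Longrightarrow> b \<in> B \<Longrightarrow> tensor_eq sa sb A B [(a + a', b)] [(a, b), (a', b)]"
| add_right: "a \<in> A \<Longrightarrow> b \<in> B \<Longrightarrow> b' \<in> B \<Longrightarrow> tensor_eq sa sb A B [(a, b + b')] [(a, b), (a, b')]"
| scale: "a \<in> A \<Longrightarrow> b \<in> B \<Longrightarrow> tensor_eq sa sb A B [(sa k a, b)] [(a, sb k b)]"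
| zero: "b \<in> B \<Longrightarrow> tensor_eq sa sb A B [(0, b)] []"

text \<open>The same presentation for the threefold tensor product \<open>A \<otimes> B \<otimes> C\<close>.\<close>

inductive tensor3_eq ::
    "('k \<Rightarrow> 'a::ab_group_add \<Rightarrow> 'a) \<Rightarrow> ('k \<Rightarrow> 'b::ab_group_add \<Rightarrow> 'b) \<Rightarrow>
      ('k \<Rightarrow> 'c::ab_group_add \<Rightarrow> 'c) \<Rightarrow> 'a set \<Rightarrow> 'b set \<Rightarrow> 'c set \<Rightarrow>
      ('a \<times> 'b \<times> 'c) list \<Rightarrow> ('a \<times> 'b \<times> 'c) list \<Rightarrow> bool"
  for sa :: "'k \<Rightarrow> 'a::ab_group_add \<Rightarrow> 'a" and sb :: "'k \<Rightarrow> 'b::ab_group_add \<Rightarrow> 'b"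
    and sc :: "'k \<Rightarrow> 'c::ab_group_add \<Rightarrow> 'c"
    and A :: "'a set" and B :: "'b set" and C :: "'c set"
where
  refl: "set xs \<subseteq> A \<times> B \<times> C \<Longrightarrow> tensor3_eq sa sb sc A B C xs xs"
| sym: "tensor3_eq sa sb sc A B C xs ys \<Longrightarrow> tensor3_eq sa sb sc A B C ys xs"
| trans: "tensor3_eq sa sb sc A B C xs ys \<Longrightarrow> tensor3_eq sa sb sc A B C ys zs \<Longrightarrow>
    tensor3_eq sa sb sc A B C xs zs"
| append: "tensor3_eq sa sb sc A B C xs xs' \<Longrightarrow> tensor3_eq sa sb sc A B C ys ys' \<Longrightarrow>
    tensor3_eq sa sb sc A B C (xs @ ys) (xs' @ ys')"
| commute: "set xs \<subseteq> A \<times> B \<times> C \<Longrightarrow> set ys \<subseteq> A \<times> B \<times> C \<Longrightarrow>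
    tensor3_eq sa sb sc A B C (xs @ ys) (ys @ xs)"
| add1: "a \<in> A \<Longrightarrow> a' \<in> A \<Longrightarrow> b \<in> B \<Longrightarrow> c \<in> C \<Longrightarrow>
    tensor3_eq sa sb sc A B C [(a + a', b, c)] [(a, b, c), (a', b, c)]"
| add2: "a \<in> A \<Longrightarrow> b \<in> B \<Longrightarrow> b' \<in> B \<Longrightarrow> c \<in> C \<Longrightarrow>
    tensor3_eq sa sb sc A B C [(a, b + b', c)] [(a, b, c), (a, b', c)]"
| add3: "a \<in> A \<Longrightarrow> b \<in> B \<Longrightarrow> c \<in> C \<Longrightarrow> c' \<in> C \<Longrightarrow>
    tensor3_eq sa sb sc A B C [(a, b, c + c')] [(a, b, c), (a, b, c')]"
| scale12: "a \<in> A \<Longrightarrow> b \<in> B \<Longrightarrow> c \<in> C \<Longrightarrow>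
    tensor3_eq sa sb sc A B C [(sa k a, b, c)] [(a, sb k b, c)]"
| scale23: "a \<in> A \<Longrightarrow> b \<in> B \<Longrightarrow> c \<in> C \<Longrightarrow>
    tensor3_eq sa sb sc A B C [(a, sb k b, c)] [(a, b, sc k c)]"
| zero: "b \<in> B \<Longrightarrow> c \<in> C \<Longrightarrow> tensor3_eq sa sb sc A B C [(0, b, c)] []"

text \<open>
  The underlying vector space of the coalgebra is a whole type \<open>'c\<close>. The list \<open>\<Delta> c\<close> is a Sweedler
  representation \<open>c\<^sub>1 \<otimes> c\<^sub>2\<close> of the comultiplication of \<open>c\<close>. The choice of representing list is
  arbitrary: all requirements are on the element of \<open>C \<otimes> C\<close> that it stands for.
\<close>

locale coalgebra = vector_space scale
  for scale :: "'k::field \<Rightarrow> 'c::ab_group_add \<Rightarrow> 'c" +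
  fixes \<Delta> :: "'c \<Rightarrow> ('c \<times> 'c) list"
    and \<epsilon> :: "'c \<Rightarrow> 'k"
  assumes comult_add:
      "tensor_eq scale scale UNIV UNIV (\<Delta> (x + y)) (\<Delta> x @ \<Delta> y)"
    and comult_scale:
      "tensor_eq scale scale UNIV UNIV (\<Delta> (scale k x)) [(scale k a, b). (a, b) \<leftarrow> \<Delta> x]"
    and coassoc:
      "tensor3_eq scale scale scale UNIV UNIV UNIV
        [(p, q, b). (a, b) \<leftarrow> \<Delta> x, (p, q) \<leftarrow> \<Delta> a]
        [(a, p, q). (a, b) \<leftarrow> \<Delta> x, (p, q) \<leftarrow> \<Delta> b]"
    and counit_linear: "Vector_Spaces.linear scale (*) \<epsilon>"
    and counit_left: "(\<Sum>(a, b)\<leftarrow>\<Delta> x. scale (\<epsilon> a) b) = x"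
    and counit_right: "(\<Sum>(a, b)\<leftarrow>\<Delta> x. scale (\<epsilon> b) a) = x"
begin

definition left_subcomodule :: "'c set \<Rightarrow> bool" where
  "left_subcomodule D \<longleftrightarrow> subspace D \<and>
    (\<forall>d\<in>D. \<exists>xs. set xs \<subseteq> UNIV \<times> D \<and> tensor_eq scale scale UNIV UNIV (\<Delta> d) xs)"

definition dual :: "('c \<Rightarrow> 'k) set" where
  "dual = {f. Vector_Spaces.linear scale (*) f}"

definition conv :: "('c \<Rightarrow> 'k) \<Rightarrow> ('c \<Rightarrow> 'k) \<Rightarrow> 'c \<Rightarrow> 'k" where
  "conv f g = (\<lambda>c. \<Sum>(a, b)\<leftarrow>\<Delta> c. f a * g b)"

text \<open>
  Modules over the dual algebra have a whole type \<open>'m\<close> as carrier. In \<open>act f m\<close> only the values at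
  \<open>f \<in> dual\<close> matter; it stands for \<open>f \<cdot> m\<close> in a left module and for \<open>m \<cdot> f\<close> in a right module.
\<close>

definition left_module :: "(('c \<Rightarrow> 'k) \<Rightarrow> 'm::ab_group_add \<Rightarrow> 'm) \<Rightarrow> bool" where
  "left_module act \<longleftrightarrow>
    (\<forall>f\<in>dual. \<forall>m n. act f (m + n) = act f m + act f n) \<and>
    (\<forall>f\<in>dual. \<forall>g\<in>dual. \<forall>m. act (\<lambda>c. f c + g c) m = act f m + act g m) \<and>
    (\<forall>f\<in>dual. \<forall>g\<in>dual. \<forall>m. act (conv f g) m = act f (act g m)) \<and>
    (\<forall>m. act \<epsilon> m = m)"

definition right_module :: "(('c \<Rightarrow> 'k) \<Rightarrow> 'm::ab_group_add \<Rightarrow> 'm) \<Rightarrow> bool" where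
  "right_module act \<longleftrightarrow>
    (\<forall>f\<in>dual. \<forall>m n. act f (m + n) = act f m + act f n) \<and>
    (\<forall>f\<in>dual. \<forall>g\<in>dual. \<forall>m. act (\<lambda>c. f c + g c) m = act f m + act g m) \<and>
    (\<forall>f\<in>dual. \<forall>g\<in>dual. \<forall>m. act (conv f g) m = act g (act f m)) \<and>
    (\<forall>m. act \<epsilon> m = m)"

definition submodule :: "(('c \<Rightarrow> 'k) \<Rightarrow> 'm::ab_group_add \<Rightarrow> 'm) \<Rightarrow> 'm set \<Rightarrow> bool" where
  "submodule act N \<longleftrightarrow> 0 \<in> N \<and> (\<forall>m\<in>N. \<forall>n\<in>N. m + n \<in> N) \<and> (\<forall>f\<in>dual. \<forall>n\<in>N. act f n \<in> N)"

definition finitely_generated :: "(('c \<Rightarrow> 'k) \<Rightarrow> 'm::ab_group_add \<Rightarrow> 'm) \<Rightarrow> bool" where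
  "finitely_generated act \<longleftrightarrow>
    (\<exists>S. finite S \<and> (\<forall>m. \<exists>r. (\<forall>s\<in>S. r s \<in> dual) \<and> m = (\<Sum>s\<in>S. act (r s) s)))"

definition direct_summand :: "(('c \<Rightarrow> 'k) \<Rightarrow> 'm::ab_group_add \<Rightarrow> 'm) \<Rightarrow> 'm set \<Rightarrow> bool" where
  "direct_summand act P \<longleftrightarrow> submodule act P \<and>
    (\<exists>Q. submodule act Q \<and> P \<inter> Q = {0} \<and> (\<forall>m. \<exists>p\<in>P. \<exists>q\<in>Q. m = p + q))"

text \<open>The \<open>K\<close>-vector space structure of a module comes from the unit map \<open>k \<mapsto> k \<epsilon>\<close> of the dual algebra.\<close>

definition module_scale :: "(('c \<Rightarrow> 'k) \<Rightarrow> 'm::ab_group_add \<Rightarrow> 'm) \<Rightarrow> 'k \<Rightarrow> 'm \<Rightarrow> 'm" where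
  "module_scale act k m = act (\<lambda>c. k * \<epsilon> c) m"

text \<open>
  In the two comodule definitions, \<open>N\<close> is a subspace of a vector space with scalar multiplication
  \<open>s\<close>, and \<open>\<rho> n\<close> represents the coaction of \<open>n\<close>, an element of \<open>N \<otimes> C\<close> (written \<open>n\<^sub>0 \<otimes> n\<^sub>1\<close>) or of
  \<open>C \<otimes> N\<close>; the values of \<open>\<rho>\<close> outside \<open>N\<close> are irrelevant.
\<close>

definition right_comodule ::
    "('k \<Rightarrow> 'm::ab_group_add \<Rightarrow> 'm) \<Rightarrow> 'm set \<Rightarrow> ('m \<Rightarrow> ('m \<times> 'c) list) \<Rightarrow> bool" where
  "right_comodule s N \<rho> \<longleftrightarrow> vector_space s \<and> module.subspace s N \<and>
    (\<forall>n\<in>N. set (\<rho> n) \<subseteq> N \<times> UNIV) \<and>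
    (\<forall>m\<in>N. \<forall>n\<in>N. tensor_eq s scale N UNIV (\<rho> (m + n)) (\<rho> m @ \<rho> n)) \<and>
    (\<forall>k. \<forall>n\<in>N. tensor_eq s scale N UNIV (\<rho> (s k n)) [(s k m, c). (m, c) \<leftarrow> \<rho> n]) \<and>
    (\<forall>n\<in>N. tensor3_eq s scale scale N UNIV UNIV
      [(p, q, c). (m, c) \<leftarrow> \<rho> n, (p, q) \<leftarrow> \<rho> m]
      [(m, p, q). (m, c) \<leftarrow> \<rho> n, (p, q) \<leftarrow> \<Delta> c]) \<and>
    (\<forall>n\<in>N. (\<Sum>(m, c)\<leftarrow>\<rho> n. s (\<epsilon> c) m) = n)"

definition left_comodule ::
    "('k \<Rightarrow> 'm::ab_group_add \<Rightarrow> 'm) \<Rightarrow> 'm set \<Rightarrow> ('m \<Rightarrow> ('c \<times> 'm) list) \<Rightarrow> bool" where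
  "left_comodule s N \<rho> \<longleftrightarrow> vector_space s \<and> module.subspace s N \<and>
    (\<forall>n\<in>N. set (\<rho> n) \<subseteq> UNIV \<times> N) \<and>
    (\<forall>m\<in>N. \<forall>n\<in>N. tensor_eq scale s UNIV N (\<rho> (m + n)) (\<rho> m @ \<rho> n)) \<and>
    (\<forall>k. \<forall>n\<in>N. tensor_eq scale s UNIV N (\<rho> (s k n)) [(c, s k m). (c, m) \<leftarrow> \<rho> n]) \<and>
    (\<forall>n\<in>N. tensor3_eq scale scale s UNIV UNIV N
      [(p, q, m). (c, m) \<leftarrow> \<rho> n, (p, q) \<leftarrow> \<Delta> c]
      [(c, p, q). (c, m) \<leftarrow> \<rho> n, (p, q) \<leftarrow> \<rho> m]) \<and>
    (\<forall>n\<in>N. (\<Sum>(c, m)\<leftarrow>\<rho> n. s (\<epsilon> c) m) = n)"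

definition left_rational :: "(('c \<Rightarrow> 'k) \<Rightarrow> 'm::ab_group_add \<Rightarrow> 'm) \<Rightarrow> 'm set \<Rightarrow> bool" where
  "left_rational act N \<longleftrightarrow> submodule act N \<and>
    (\<exists>\<rho>. right_comodule (module_scale act) N \<rho> \<and>
      (\<forall>f\<in>dual. \<forall>n\<in>N. act f n = (\<Sum>(m, c)\<leftarrow>\<rho> n. module_scale act (f c) m)))"

definition right_rational :: "(('c \<Rightarrow> 'k) \<Rightarrow> 'm::ab_group_add \<Rightarrow> 'm) \<Rightarrow> 'm set \<Rightarrow> bool" where
  "right_rational act N \<longleftrightarrow> submodule act N \<and>
    (\<exists>\<rho>. left_comodule (module_scale act) N \<rho> \<and>
      (\<forall>f\<in>dual. \<forall>n\<in>N. act f n = (\<Sum>(c, m)\<leftarrow>\<rho> n. module_scale act (f c) m)))"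

definition left_Rat :: "(('c \<Rightarrow> 'k) \<Rightarrow> 'm::ab_group_add \<Rightarrow> 'm) \<Rightarrow> 'm set" where
  "left_Rat act = {sum_list ms |ms. set ms \<subseteq> \<Union> {N. left_rational act N}}"

definition right_Rat :: "(('c \<Rightarrow> 'k) \<Rightarrow> 'm::ab_group_add \<Rightarrow> 'm) \<Rightarrow> 'm set" where
  "right_Rat act = {sum_list ms |ms. set ms \<subseteq> \<Union> {N. right_rational act N}}"

text \<open>
  HOL cannot quantify over types inside a formula, so the splitting properties refer to the modules
  whose carrier is a given type \<open>'m\<close>. The full property is the one for arbitrary \<open>'m\<close>.
\<close>

definition left_finite_Rat_splitting :: "'m::ab_group_add itself \<Rightarrow> bool" where
  "left_finite_Rat_splitting (_ :: 'm itself) \<longleftrightarrow>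
    (\<forall>act :: ('c \<Rightarrow> 'k) \<Rightarrow> 'm \<Rightarrow> 'm.
      left_module act \<and> finitely_generated act \<longrightarrow> direct_summand act (left_Rat act))"

definition right_finite_Rat_splitting :: "'m::ab_group_add itself \<Rightarrow> bool" where
  "right_finite_Rat_splitting (_ :: 'm itself) \<longleftrightarrow>
    (\<forall>act :: ('c \<Rightarrow> 'k) \<Rightarrow> 'm \<Rightarrow> 'm.
      right_module act \<and> finitely_generated act \<longrightarrow> direct_summand act (right_Rat act))"

end

locale chain_coalgebra = coalgebra +
  assumes chain: "left_subcomodule D \<Longrightarrow> left_subcomodule E \<Longrightarrow> D \<subseteq> E \<or> E \<subseteq> D"

end

theory Submission
  imports Defs
begin

text \<open>
  Write \<open>A\<close> for the dual algebra, \<open>f \<rightharpoonup> c\<close> for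
  \<open>c\<^sub>1 f(c\<^sub>2)\<close> (\<open>left_hit\<close>) and \<open>c \<leftharpoonup> f\<close> for
  \<open>f(c\<^sub>1) c\<^sub>2\<close> (\<open>right_hit\<close>). The theorem holds because \<open>A\<close> behaves
  like a complete discrete valuation ring, possibly noncommutative and possibly with a nilpotent maximal ideal, and
  because over such a ring the torsion submodule of a finitely generated module splits off. The rational part of a
  module is exactly its torsion submodule.

  \<^emph>\<open>The uniformizer.\<close> Since
  \<open>(f g)(c) = f(g \<rightharpoonup> c) = g(c \<leftharpoonup> f)\<close>, divisibility in \<open>A\<close> is
  inclusion of kernels: \<open>g\<close> lies in \<open>A f\<close> iff it vanishes on the kernel of
  \<open>f \<rightharpoonup> _\<close>, and in \<open>f A\<close> iff it vanishes on the kernel of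
  \<open>_ \<leftharpoonup> f\<close> (\<open>right_multiple_iff\<close>, \<open>left_multiple_iff\<close>). The
  kernel of \<open>f \<rightharpoonup> _\<close> is stable under the right action, hence a left subcomodule, and by
  hypothesis these form a chain. If \<open>C\<close> is not zero, local finiteness gives a least nonzero left
  subcomodule \<open>S\<close>, and a functional that does not vanish on \<open>S\<close> is a unit
  (\<open>invertible_if_nonzero_on_S\<close>). A functional \<open>t\<close> that vanishes on \<open>S\<close> but not
  on the next left subcomodule (or \<open>t = 0\<close> if \<open>S = C\<close>) has \<open>S\<close> as the kernel of
  \<open>t \<rightharpoonup> _\<close>, so the nonunits are \<open>A t\<close>. The chain hypothesis is one-sided, and
  the crucial step is that the nonunits are also \<open>t A\<close>, that is, that \<open>S\<close> is the kernel of
  \<open>_ \<leftharpoonup> t\<close> as well (\<open>right_kernel_t\<close>). This is a dimension argument: if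
  \<open>S \<noteq> C\<close>, both \<open>t \<rightharpoonup> _\<close> and \<open>_ \<leftharpoonup> t\<close> map
  the second layer \<open>{x. t \<rightharpoonup> x \<in> S}\<close> onto the finite-dimensional space
  \<open>S\<close>, so they have the same kernel there, and local nilpotency of \<open>t \<rightharpoonup> _\<close>
  carries the equality to all of \<open>C\<close>.

  \<^emph>\<open>Modules.\<close> The properties of \<open>t\<close> used from there on are collected in
  \<open>uniformized_coalgebra\<close>; they are left-right symmetric. An element \<open>m\<close> of a left module is
  torsion if \<open>t\<^sup>n m = 0\<close> for some \<open>n\<close>. As \<open>A t\<^sup>n\<close> is the
  annihilator of a finite-dimensional subspace of \<open>C\<close>, a dual basis of that subspace provides a coaction
  on \<open>{m. t\<^sup>n m = 0}\<close>; conversely a finite coaction involves only elements of \<open>C\<close> on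
  which high powers of \<open>t\<close> vanish (\<open>left_Rat_eq_torsion\<close>). A minimal set of generators
  modulo torsion is independent modulo torsion, because in a relation the greatest common power of \<open>t\<close>
  can be cancelled, which leaves a unit coefficient and makes a generator superfluous. The submodule spanned by these
  generators is a complement (\<open>torsion_direct_summand\<close>).

  \<^emph>\<open>The other side.\<close> Right \<open>A\<close>-modules are left modules over the dual algebra of the
  coopposite coalgebra, to which the symmetry of \<open>uniformized_coalgebra\<close> transfers the result.
\<close>

section \<open>Linear algebra\<close>

context vector_space
begin

lemma scale_sum_list: "scale k (\<Sum>x\<leftarrow>xs. g x) = (\<Sum>x\<leftarrow>xs. scale k (g x))"
  by (induction xs) (simp_all add: scale_right_distrib)

lemma sum_list_scale: "scale (\<Sum>x\<leftarrow>xs. g x) v = (\<Sum>x\<leftarrow>xs. scale (g x) v)"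
  by (induction xs) (simp_all add: scale_left_distrib)

text \<open>
  The coordinates are taken with respect to a basis of the whole space that extends a basis of
  \<open>span F\<close>, so that they are functionals on the whole space.
\<close>

lemma finite_coordinates:
  assumes "finite F"
  shows "\<exists>bs e. (\<forall>b. Vector_Spaces.linear scale (*) (e b)) \<and> set bs \<subseteq> F \<and>
    (\<forall>x\<in>span F. x = (\<Sum>b\<leftarrow>bs. scale (e b x) b))"
proof -
  obtain B where B: "B \<subseteq> F" "independent B" "F \<subseteq> span B"
    using maximal_independent_subset by blast
  then have "finite B" using assms finite_subset by blast
  then obtain bs where bs: "set bs = B" "distinct bs"
    using finite_distinct_list by blast
  define E where "E = extend_basis B"
  have E: "independent E" "span E = UNIV" "B \<subseteq> E"
    using B(2) by (simp_all add: E_def independent_extend_basis extend_basis_superset)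
  define e where "e b x = representation E x b" for b x
  have "Vector_Spaces.linear scale (*) (e b)" for b
    unfolding e_def using E by (intro linear_representation) auto
  moreover have "x = (\<Sum>b\<leftarrow>bs. scale (e b x) b)" if "x \<in> span F" for x
  proof -
    have x: "x \<in> span B" using that B(3) span_minimal subspace_span by blast
    have "(\<Sum>b\<leftarrow>bs. scale (e b x) b) = (\<Sum>b\<in>B. scale (representation B x b) b)"
      using bs E representation_extend[OF E(1) x E(3)]
      by (simp add: sum_list_distinct_conv_sum_set e_def)
    also have "\<dots> = x"
      using B \<open>finite B\<close> x by (intro sum_representation_eq) auto
    finally show ?thesis by simp
  qed
  ultimately show ?thesis using B bs by blast
qed

lemma functional_separates_subspace:
  assumes W: "subspace W" and "x \<notin> W"
  shows "\<exists>f. Vector_Spaces.linear scale (*) f \<and> (\<forall>w\<in>W. f w = 0) \<and> f x \<noteq> 0"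
proof -
  obtain B where B: "B \<subseteq> W" "independent B" "W \<subseteq> span B"
    using maximal_independent_subset by blast
  have WB: "span B = W" using B W by (simp add: span_subspace)
  have ind: "independent (insert x B)"
    using assms(2) B(2) WB by (simp add: independent_insertI)
  interpret vector_space_pair scale "(*)"
    using vector_space_axioms by (simp add: vector_space_pair_def vector_space_def algebra_simps)
  obtain f where f: "Vector_Spaces.linear scale (*) f"
      "\<forall>y\<in>insert x B. f y = (if y = x then 1 else 0)"
    using linear_independent_extend[OF ind, of "\<lambda>y. if y = x then 1 else 0"] by blast
  have "x \<notin> B" using assms(2) B(1) by auto
  then have "f y = 0" if "y \<in> B" for y using f(2) that by auto
  then have "f w = 0" if "w \<in> W" for w
    using linear_eq_0_on_span[OF f(1)] that WB by blast
  then show ?thesis using f by auto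
qed

lemma subspace_eq_if_annihilated:
  assumes "subspace W"
    and "\<And>f. Vector_Spaces.linear scale (*) f \<Longrightarrow> \<forall>w\<in>W. f w = 0 \<Longrightarrow> \<forall>v\<in>V. f v = 0"
  shows "V \<subseteq> W"
  using assms functional_separates_subspace by blast

lemma eq_if_functionals_eq:
  assumes "\<And>f. Vector_Spaces.linear scale (*) f \<Longrightarrow> f x = f y"
  shows "x = y"
proof (rule ccontr)
  assume "x \<noteq> y"
  then obtain f where f: "Vector_Spaces.linear scale (*) f" "f (x - y) \<noteq> 0"
    using functional_separates_subspace[of "{0}" "x - y"] by auto
  then have "f x - f y \<noteq> 0"
    using module_hom.diff[OF linear_iff_module_hom[THEN iffD1, OF f(1)]] by metis
  then show False using assms f(1) by simp
qed

lemma linear_factor_through: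
  assumes f: "Vector_Spaces.linear scale scale f" and g: "Vector_Spaces.linear scale (*) g"
    and ker: "\<And>x. f x = 0 \<Longrightarrow> g x = 0"
  shows "\<exists>h. Vector_Spaces.linear scale (*) h \<and> (\<forall>x. g x = h (f x))"
proof -
  interpret vector_space_pair scale scale
    using vector_space_axioms by (simp add: vector_space_pair_def)
  obtain s where s: "Vector_Spaces.linear scale scale s" "\<forall>v\<in>range f. f (s v) = v"
    using linear_exists_right_inverse_on[OF f subspace_UNIV] by blast
  \<comment> \<open>\<open>h\<close> is \<open>g\<close> composed with a linear section of \<open>f\<close>: the choice of preimage does not affect \<open>g\<close>.\<close>
  have "g x = g (s (f x))" for x
  proof -
    have "f (x - s (f x)) = 0"
      using s(2) by (simp add: linear_diff[OF f])
    then show ?thesis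
      using ker module_hom.diff[OF linear_iff_module_hom[THEN iffD1, OF g]] by (metis right_minus_eq)
  qed
  moreover have "Vector_Spaces.linear scale (*) (\<lambda>x. g (s x))"
    using Vector_Spaces.linear_compose[OF s(1) g] by (simp add: o_def)
  ultimately show ?thesis by blast
qed

text \<open>
  The ambient space may have infinite dimension, where \<open>dim\<close> alone gives no information; the finite
  spanning set of \<open>V\<close> is what makes the comparison meaningful.
\<close>

lemma dim_strict_mono:
  assumes "subspace U" "U \<subset> V" "V \<subseteq> span F" "finite F"
  shows "dim U < dim V"
proof -
  obtain B where B: "B \<subseteq> U" "independent B" "U \<subseteq> span B" "card B = dim U"
    using basis_exists by blast
  have UB: "span B = U" using B assms(1) by (simp add: span_subspace)
  obtain x where x: "x \<in> V" "x \<notin> U" using assms(2) by blast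
  then have ind: "independent (insert x B)" using UB B by (simp add: independent_insertI)
  have sub: "insert x B \<subseteq> V" using x B assms(2) by auto
  obtain C where C: "insert x B \<subseteq> C" "C \<subseteq> V" "independent C" "V \<subseteq> span C"
    by (rule maximal_independent_subset_extend[OF sub ind])
  have "finite C" using independent_span_bound[OF assms(4) C(3) order.trans[OF C(2) assms(3)]] by simp
  have "x \<notin> B" using x B by auto
  then have "card B < card C"
    using \<open>finite C\<close> C(1) by (intro psubset_card_mono) auto
  then show ?thesis using B(4) C basis_card_eq_dim by metis
qed

text \<open>A vector in the kernel can be put in a basis and then dropped from the image of the basis.\<close>
lemma image_spanned_by_fewer:
  assumes f: "Vector_Spaces.linear scale scale f" and D: "subspace D" "D \<subseteq> span F" "finite F"
    and x: "x \<in> D" "x \<noteq> 0" "f x = 0"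
  shows "\<exists>G. finite G \<and> card G < card F \<and> f ` D \<subseteq> span G"
proof -
  have "independent {x}" using x by simp
  obtain B where B: "{x} \<subseteq> B" "B \<subseteq> D" "independent B" "D \<subseteq> span B"
    by (rule maximal_independent_subset_extend[OF _ \<open>independent {x}\<close>]) (use x in auto)
  have fin: "finite B" "card B \<le> card F"
    using independent_span_bound[OF D(3) B(3) order.trans[OF B(2) D(2)]] by auto
  interpret vector_space_pair scale scale
    using vector_space_axioms by (simp add: vector_space_pair_def)
  have "f ` D \<subseteq> span (f ` B)"
    by (rule linear_spans_image[OF f B(4)])
  also have "f ` B = insert 0 (f ` (B - {x}))" using B(1) x(3) by force
  finally have "f ` D \<subseteq> span (f ` (B - {x}))" by simp
  moreover have "card (f ` (B - {x})) < card F"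
    using fin B card_image_le[of "B - {x}" f] card_Diff1_less[of B x] by fastforce
  ultimately show ?thesis using fin by blast
qed

lemma surjective_endomorphism_injective:
  assumes f: "Vector_Spaces.linear scale scale f" and D: "subspace D" "D \<subseteq> span F" "finite F"
    and surj: "D \<subseteq> f ` D" and x: "x \<in> D" "f x = 0"
  shows "x = 0"
proof (rule ccontr)
  assume "x \<noteq> 0"
  obtain B where B: "B \<subseteq> D" "independent B" "D \<subseteq> span B"
    using maximal_independent_subset by blast
  have "finite B" using independent_span_bound[OF D(3) B(2) order.trans[OF B(1) D(2)]] by auto
  then obtain G where "finite G" "card G < card B" "f ` D \<subseteq> span G"
    using image_spanned_by_fewer[OF f D(1) B(3) _ x(1) \<open>x \<noteq> 0\<close> x(2)] by blast
  then show False using independent_span_bound[OF _ B(2), of G] B(1) surj by force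
qed

text \<open>
  A space is spanned by a spanning set of the kernel and preimages of a spanning set of the image.
\<close>

lemma finite_span_if_kernel_image:
  assumes f: "Vector_Spaces.linear scale scale f" and D: "subspace D"
    and ker: "finite F" "\<And>x. f x = 0 \<Longrightarrow> x \<in> span F" and img: "finite G" "f ` D \<subseteq> span G"
  shows "\<exists>H. finite H \<and> D \<subseteq> span H"
proof -
  interpret vector_space_pair scale scale
    using vector_space_axioms by (simp add: vector_space_pair_def)
  obtain s where s: "range s \<subseteq> D" "Vector_Spaces.linear scale scale s" "\<forall>v\<in>f ` D. f (s v) = v"
    using linear_exists_right_inverse_on[OF f D] by blast
  have "x \<in> span (F \<union> s ` G)" if "x \<in> D" for x
  proof -
    have "f (x - s (f x)) = 0" using s(3) that by (simp add: linear_diff[OF f])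
    then have "x - s (f x) \<in> span (F \<union> s ` G)"
      using ker(2) span_mono[of F "F \<union> s ` G"] by blast
    moreover have "s (f x) \<in> span (s ` G)"
      using that img(2) linear_spans_image[OF s(2), of "{f x}" G] by auto
    then have "s (f x) \<in> span (F \<union> s ` G)"
      using span_mono[of "s ` G" "F \<union> s ` G"] by blast
    ultimately show ?thesis using span_add by fastforce
  qed
  then show ?thesis using ker(1) img(1) by (intro exI[of _ "F \<union> s ` G"]) auto
qed

end

section \<open>Tensors represented by lists\<close>

text \<open>
  Equal tensors have equal images: a balanced biadditive map factors through the tensor product.
\<close>

lemma tensor_eq_sum:
  fixes \<beta> :: "'a::ab_group_add \<Rightarrow> 'b::ab_group_add \<Rightarrow> 'd::ab_group_add"
  assumes "tensor_eq sa sb UNIV UNIV xs ys"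
    and "\<And>a a' b. \<beta> (a + a') b = \<beta> a b + \<beta> a' b"
    and "\<And>a b b'. \<beta> a (b + b') = \<beta> a b + \<beta> a b'"
    and "\<And>k a b. \<beta> (sa k a) b = \<beta> a (sb k b)"
  shows "(\<Sum>(a, b)\<leftarrow>xs. \<beta> a b) = (\<Sum>(a, b)\<leftarrow>ys. \<beta> a b)"
  using assms(1)
proof induction
  case (zero b)
  have "\<beta> 0 b = 0" using assms(2)[of 0 0 b] by simp
  then show ?case by simp
qed (simp_all add: assms(2-) algebra_simps)

lemma tensor3_eq_sum:
  fixes \<beta> :: "'a::ab_group_add \<Rightarrow> 'b::ab_group_add \<Rightarrow> 'c::ab_group_add \<Rightarrow> 'd::ab_group_add"
  assumes "tensor3_eq sa sb sc UNIV UNIV UNIV xs ys"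
    and "\<And>a a' b c. \<beta> (a + a') b c = \<beta> a b c + \<beta> a' b c"
    and "\<And>a b b' c. \<beta> a (b + b') c = \<beta> a b c + \<beta> a b' c"
    and "\<And>a b c c'. \<beta> a b (c + c') = \<beta> a b c + \<beta> a b c'"
    and "\<And>k a b c. \<beta> (sa k a) b c = \<beta> a (sb k b) c"
    and "\<And>k a b c. \<beta> a (sb k b) c = \<beta> a b (sc k c)"
  shows "(\<Sum>(a, b, c)\<leftarrow>xs. \<beta> a b c) = (\<Sum>(a, b, c)\<leftarrow>ys. \<beta> a b c)"
  using assms(1)
proof induction
  case (zero b c)
  have "\<beta> 0 b c = 0" using assms(2)[of 0 0 b c] by simp
  then show ?case by simp
qed (simp_all add: assms(2-4) assms(5,6)[symmetric] algebra_simps)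

definition swap3 :: "'a \<times> 'b \<times> 'c \<Rightarrow> 'c \<times> 'b \<times> 'a" where
  "swap3 = (\<lambda>(a, b, c). (c, b, a))"

lemma swap3_swap3 [simp]: "swap3 (swap3 x) = x" and swap3_simp [simp]: "swap3 (a, b, c) = (c, b, a)"
  by (auto simp: swap3_def split: prod.splits)

lemma tensor_eq_swap:
  assumes "tensor_eq sa sb A B xs ys" "vector_space sa" "vector_space sb" "0 \<in> A"
  shows "tensor_eq sb sa B A (map prod.swap xs) (map prod.swap ys)"
  using assms(1)
proof induction
  case (refl xs)
  then show ?case by (intro tensor_eq.refl) auto
next
  case (append xs xs' ys ys')
  then show ?case by (simp add: tensor_eq.append)
next
  case (commute xs ys)
  have "tensor_eq sb sa B A (map prod.swap xs @ map prod.swap ys) (map prod.swap ys @ map prod.swap xs)"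
    by (rule tensor_eq.commute) (use commute in auto)
  then show ?case by simp
next
  case (zero b)
  interpret a: vector_space sa by fact
  interpret b: vector_space sb by fact
  \<comment> \<open>The presentation kills \<open>0 \<otimes> b\<close>, so \<open>b \<otimes> 0\<close> is reached by moving the scalar \<open>0\<close> across.\<close>
  have "tensor_eq sb sa B A [(sb 0 b, 0)] [(b, sa 0 0)]"
    by (rule tensor_eq.scale) (use zero assms in auto)
  then have "tensor_eq sb sa B A [(b, 0)] [(0, 0)]"
    using tensor_eq.sym by fastforce
  moreover have "tensor_eq sb sa B A [(0, 0)] []" using assms(4) by (rule tensor_eq.zero)
  ultimately show ?case using tensor_eq.trans by fastforce
next
  case (trans xs ys zs)
  then show ?case using tensor_eq.trans by blast
qed (simp_all add: tensor_eq.sym tensor_eq.add_left tensor_eq.add_right tensor_eq.sym[OF tensor_eq.scale])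

lemma tensor3_eq_swap:
  assumes "tensor3_eq sa sb sc A B C xs ys" "vector_space sa" "vector_space sb" "vector_space sc"
    and "0 \<in> A" "0 \<in> B"
  shows "tensor3_eq sc sb sa C B A (map swap3 xs) (map swap3 ys)"
  using assms(1)
proof induction
  case (refl xs)
  then show ?case by (intro tensor3_eq.refl) (auto simp: swap3_def)
next
  case (append xs xs' ys ys')
  then show ?case by (simp add: tensor3_eq.append)
next
  case (commute xs ys)
  have "tensor3_eq sc sb sa C B A (map swap3 xs @ map swap3 ys) (map swap3 ys @ map swap3 xs)"
    by (rule tensor3_eq.commute) (use commute in \<open>auto simp: swap3_def\<close>)
  then show ?case by simp
next
  case (zero b c)
  interpret a: vector_space sa by fact
  interpret b: vector_space sb by fact
  interpret c: vector_space sc by fact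
  have "tensor3_eq sc sb sa C B A [(c, sb 0 b, 0)] [(c, b, sa 0 0)]"
    by (rule tensor3_eq.scale23) (use zero assms in auto)
  then have 1: "tensor3_eq sc sb sa C B A [(c, b, 0)] [(c, 0, 0)]"
    using tensor3_eq.sym by fastforce
  have "tensor3_eq sc sb sa C B A [(sc 0 c, 0, 0)] [(c, sb 0 0, 0)]"
    by (rule tensor3_eq.scale12) (use zero assms in auto)
  then have 2: "tensor3_eq sc sb sa C B A [(c, 0, 0)] [(0, 0, 0)]"
    using tensor3_eq.sym by fastforce
  have "tensor3_eq sc sb sa C B A [(0, 0, 0)] []" using assms(5,6) by (rule tensor3_eq.zero[rotated])
  then show ?case using 1 2 by (auto intro: tensor3_eq.trans)
next
  case (trans xs ys zs)
  then show ?case using tensor3_eq.trans by blast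
qed (simp_all add: tensor3_eq.sym tensor3_eq.add1 tensor3_eq.add2 tensor3_eq.add3
    tensor3_eq.sym[OF tensor3_eq.scale12] tensor3_eq.sym[OF tensor3_eq.scale23])

lemma tensor_eq_swap_iff:
  assumes "vector_space sa" "vector_space sb" "0 \<in> A" "0 \<in> B"
  shows "tensor_eq sb sa B A (map prod.swap xs) (map prod.swap ys) \<longleftrightarrow> tensor_eq sa sb A B xs ys"
  using tensor_eq_swap[of sb sa B A "map prod.swap xs" "map prod.swap ys"]
    tensor_eq_swap[of sa sb A B xs ys] assms
  by (auto simp: o_def)

lemma tensor3_eq_swap_iff:
  assumes "vector_space sa" "vector_space sb" "vector_space sc" "0 \<in> A" "0 \<in> B" "0 \<in> C"
  shows "tensor3_eq sc sb sa C B A (map swap3 xs) (map swap3 ys) \<longleftrightarrow> tensor3_eq sa sb sc A B C xs ys"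
  using tensor3_eq_swap[of sc sb sa C B A "map swap3 xs" "map swap3 ys"]
    tensor3_eq_swap[of sa sb sc A B C xs ys] assms
  by (auto simp: o_def)


text \<open>
  The part of the two tensor presentations that makes a list of pure tensors a formal commutative sum.
  Reordering such sums concerns this part alone, so it is treated once for both.
\<close>

locale list_congruence =
  fixes R :: "'x list \<Rightarrow> 'x list \<Rightarrow> bool" and X :: "'x set"
  assumes refl: "set xs \<subseteq> X \<Longrightarrow> R xs xs"
    and sym: "R xs ys \<Longrightarrow> R ys xs"
    and trans [trans]: "R xs ys \<Longrightarrow> R ys zs \<Longrightarrow> R xs zs"
    and append: "R xs xs' \<Longrightarrow> R ys ys' \<Longrightarrow> R (xs @ ys) (xs' @ ys')"
    and commute: "set xs \<subseteq> X \<Longrightarrow> set ys \<subseteq> X \<Longrightarrow> R (xs @ ys) (ys @ xs)"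
begin

lemma concat_cong:
  "(\<And>c. c \<in> set cs \<Longrightarrow> R (f c) (g c)) \<Longrightarrow> R (concat (map f cs)) (concat (map g cs))"
  by (induction cs) (auto intro: refl append)

lemma concat_append:
  assumes "\<And>c. c \<in> set cs \<Longrightarrow> set (f c) \<subseteq> X" "\<And>c. c \<in> set cs \<Longrightarrow> set (g c) \<subseteq> X"
  shows "R (concat (map (\<lambda>c. f c @ g c) cs)) (concat (map f cs) @ concat (map g cs))"
  using assms
proof (induction cs)
  case Nil
  then show ?case by (simp add: refl)
next
  case (Cons c cs)
  let ?F = "concat (map f cs)" and ?G = "concat (map g cs)"
  have sets: "set (f c) \<subseteq> X" "set (g c) \<subseteq> X" "set ?F \<subseteq> X" "set ?G \<subseteq> X"
    using Cons.prems by auto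
  have "R ((f c @ g c) @ concat (map (\<lambda>c. f c @ g c) cs)) ((f c @ g c) @ (?F @ ?G))"
    by (intro append refl Cons.IH) (use Cons.prems sets in auto)
  moreover have "R (f c @ (g c @ ?F) @ ?G) (f c @ (?F @ g c) @ ?G)"
    by (intro append refl commute) (use sets in auto)
  ultimately show ?case using trans by simp
qed

lemma concat_exchange:
  assumes "\<And>x c. x \<in> set xs \<Longrightarrow> c \<in> set cs \<Longrightarrow> set (f x c) \<subseteq> X"
  shows "R (concat (map (\<lambda>x. concat (map (f x) cs)) xs))
    (concat (map (\<lambda>c. concat (map (\<lambda>x. f x c) xs)) cs))"
  using assms
proof (induction xs)
  case Nil
  then show ?case by (induction cs) (auto intro: refl)
next
  case (Cons x xs)
  let ?g = "\<lambda>c. concat (map (\<lambda>x. f x c) xs)"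
  have "R (concat (map (f x) cs) @ concat (map (\<lambda>x. concat (map (f x) cs)) xs))
      (concat (map (f x) cs) @ concat (map ?g cs))"
    by (intro append refl Cons.IH) (use Cons.prems in auto)
  moreover have "R (concat (map (f x) cs) @ concat (map ?g cs)) (concat (map (\<lambda>c. f x c @ ?g c) cs))"
    by (rule sym, rule concat_append) (use Cons.prems in auto)
  ultimately show ?case using trans by simp
qed

text \<open>
  To bring \<open>xs\<close> to normal form, expand each entry along \<open>cs\<close>, exchange the two summations,
  and merge the terms that belong to the same \<open>c\<close>.
\<close>

lemma collect_coordinates:
  assumes "\<And>x. x \<in> set xs \<Longrightarrow> R [x] (concat (map (f x) cs))"
    and "\<And>x c. x \<in> set xs \<Longrightarrow> c \<in> set cs \<Longrightarrow> set (f x c) \<subseteq> X"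
    and "\<And>c. c \<in> set cs \<Longrightarrow> R (concat (map (\<lambda>x. f x c) xs)) [g c]"
  shows "R xs (map g cs)"
proof -
  have "R xs (concat (map (\<lambda>x. concat (map (f x) cs)) xs))"
    using concat_cong[of xs "\<lambda>x. [x]", OF assms(1)] by simp
  also have "R \<dots> (concat (map (\<lambda>c. concat (map (\<lambda>x. f x c) xs)) cs))"
    by (rule concat_exchange) (use assms(2) in auto)
  also have "R \<dots> (concat (map (\<lambda>c. [g c]) cs))"
    by (rule concat_cong) (use assms(3) in auto)
  finally show ?thesis by simp
qed

end

lemma list_congruence_tensor_eq: "list_congruence (tensor_eq sa sb A B) (A \<times> B)"
  by (unfold_locales; fact tensor_eq.refl tensor_eq.sym tensor_eq.trans tensor_eq.append tensor_eq.commute)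

lemma list_congruence_tensor3_eq: "list_congruence (tensor3_eq sa sb sc A B C) (A \<times> B \<times> C)"
  by (unfold_locales; fact tensor3_eq.refl tensor3_eq.sym tensor3_eq.trans tensor3_eq.append tensor3_eq.commute)

lemma subspace_sum_list:
  assumes "vector_space s" "module.subspace s N" "\<And>x. x \<in> set xs \<Longrightarrow> f x \<in> N"
  shows "(\<Sum>x\<leftarrow>xs. f x) \<in> N"
proof -
  interpret vector_space s by fact
  show ?thesis using assms(2,3) by (induction xs) (auto simp: subspace_0 subspace_add)
qed

text \<open>
  Every tensor can be written with second factors from a given spanning list; the first factors are
  then obtained by applying the coordinate functionals to the second factors.
\<close>

lemma tensor_eq_coordinates:
  fixes sa :: "'k::field \<Rightarrow> 'a::ab_group_add \<Rightarrow> 'a" and sb :: "'k \<Rightarrow> 'c::ab_group_add \<Rightarrow> 'c"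
  assumes sa: "vector_space sa" and sb: "vector_space sb" and A: "module.subspace sa A"
    and xs: "set xs \<subseteq> A \<times> UNIV"
    and cs: "\<And>a b. (a, b) \<in> set xs \<Longrightarrow> b = (\<Sum>c\<leftarrow>cs. sb (e c b) c)"
  shows "tensor_eq sa sb A UNIV xs (map (\<lambda>c. (\<Sum>(a, b)\<leftarrow>xs. sa (e c b) a, c)) cs)"
proof -
  interpret a: vector_space sa by fact
  interpret b: vector_space sb by fact
  interpret list_congruence "tensor_eq sa sb A UNIV" "A \<times> UNIV"
    by (rule list_congruence_tensor_eq)
  have zero_right: "tensor_eq sa sb A UNIV [(a, 0)] []" if "a \<in> A" for a
  proof -
    have "tensor_eq sa sb A UNIV [(a, sb 0 0)] [(sa 0 a, 0)]"
      by (rule sym, rule tensor_eq.scale) (use that in auto)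
    moreover have "tensor_eq sa sb A UNIV [(0, 0)] []" by (rule tensor_eq.zero) simp
    ultimately show ?thesis using trans by fastforce
  qed
  have expand: "tensor_eq sa sb A UNIV [(a, \<Sum>c\<leftarrow>ds. sb (k c) c)] (concat (map (\<lambda>c. [(sa (k c) a, c)]) ds))"
    if a: "a \<in> A" for a ds k
  proof (induction ds)
    case Nil
    then show ?case using zero_right[OF a] by simp
  next
    case (Cons d ds)
    have "tensor_eq sa sb A UNIV [(a, sb (k d) d + (\<Sum>c\<leftarrow>ds. sb (k c) c))]
        ([(a, sb (k d) d)] @ [(a, \<Sum>c\<leftarrow>ds. sb (k c) c)])"
      using tensor_eq.add_right[OF a UNIV_I UNIV_I] by simp
    also have "tensor_eq sa sb A UNIV \<dots>
        ([(sa (k d) a, d)] @ concat (map (\<lambda>c. [(sa (k c) a, c)]) ds))"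
      by (intro append sym[OF tensor_eq.scale] Cons.IH a UNIV_I)
    finally show ?case by simp
  qed
  have merge: "tensor_eq sa sb A UNIV (concat (map (\<lambda>x. [(u x, c)]) ys)) [(\<Sum>x\<leftarrow>ys. u x, c)]"
    if "\<And>y. y \<in> set ys \<Longrightarrow> u y \<in> A" for u :: "'a \<times> 'c \<Rightarrow> 'a" and c ys
    using that
  proof (induction ys)
    case Nil
    then show ?case using sym[OF tensor_eq.zero[of c]] by simp
  next
    case (Cons y ys)
    have "tensor_eq sa sb A UNIV ([(u y, c)] @ concat (map (\<lambda>x. [(u x, c)]) ys))
        ([(u y, c)] @ [(\<Sum>x\<leftarrow>ys. u x, c)])"
    proof (rule append)
      show "tensor_eq sa sb A UNIV [(u y, c)] [(u y, c)]" by (rule refl) (simp add: Cons.prems)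
      show "tensor_eq sa sb A UNIV (concat (map (\<lambda>x. [(u x, c)]) ys)) [(\<Sum>x\<leftarrow>ys. u x, c)]"
        by (rule Cons.IH) (simp add: Cons.prems)
    qed
    also have "tensor_eq sa sb A UNIV \<dots> [(u y + (\<Sum>x\<leftarrow>ys. u x), c)]"
      using subspace_sum_list[OF sa A, of ys u] Cons.prems
      by (simp add: sym[OF tensor_eq.add_left])
    finally show ?case by simp
  qed
  show ?thesis
  proof (rule collect_coordinates[where f = "\<lambda>(a, b) c. [(sa (e c b) a, c)]"])
    fix x assume mem: "x \<in> set xs"
    obtain a b where ab: "x = (a, b)" by (cases x)
    then have x: "x = (a, b)" "a \<in> A" "b = (\<Sum>c\<leftarrow>cs. sb (e c b) c)"
      using xs mem by (auto intro: cs)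
    show "tensor_eq sa sb A UNIV [x] (concat (map ((\<lambda>(a, b) c. [(sa (e c b) a, c)]) x) cs))"
      using expand[OF x(2), where ds = cs and k = "\<lambda>c. e c b"] x by simp
  next
    fix x c assume "x \<in> set xs"
    then show "set ((\<lambda>(a, b) c. [(sa (e c b) a, c)]) x c) \<subseteq> A \<times> UNIV"
      using xs a.subspace_scale[OF A] by (cases x) auto
  next
    fix c
    have "tensor_eq sa sb A UNIV (concat (map (\<lambda>x. [(case x of (a, b) \<Rightarrow> sa (e c b) a, c)]) xs))
        [(\<Sum>x\<leftarrow>xs. (case x of (a, b) \<Rightarrow> sa (e c b) a), c)]"
      by (rule merge) (use xs a.subspace_scale[OF A] in auto)
    moreover have "(\<lambda>x. (\<lambda>(a, b) c. [(sa (e c b) a, c)]) x c) = (\<lambda>x. [(case x of (a, b) \<Rightarrow> sa (e c b) a, c)])"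
      by (auto simp: fun_eq_iff)
    ultimately show "tensor_eq sa sb A UNIV (concat (map (\<lambda>x. (\<lambda>(a, b) c. [(sa (e c b) a, c)]) x c) xs))
        [(\<Sum>(a, b)\<leftarrow>xs. sa (e c b) a, c)]"
      by simp
  qed
qed

lemma tensor3_eq_coordinates:
  fixes sa :: "'k::field \<Rightarrow> 'a::ab_group_add \<Rightarrow> 'a" and sb :: "'k \<Rightarrow> 'c::ab_group_add \<Rightarrow> 'c"
  assumes sa: "vector_space sa" and sb: "vector_space sb" and A: "module.subspace sa A"
    and xs: "set xs \<subseteq> A \<times> UNIV"
    and cs: "\<And>a b c. (a, b, c) \<in> set xs \<Longrightarrow> b = (\<Sum>d\<leftarrow>cs. sb (e d b) d) \<and> c = (\<Sum>d\<leftarrow>cs. sb (e d c) d)"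
  shows "tensor3_eq sa sb sb A UNIV UNIV xs
    (map (\<lambda>(p, q). (\<Sum>(a, b, c)\<leftarrow>xs. sa (e p b * e q c) a, p, q)) (List.product cs cs))"
proof -
  interpret a: vector_space sa by fact
  interpret b: vector_space sb by fact
  let ?R = "tensor3_eq sa sb sb A UNIV UNIV"
  interpret list_congruence ?R "A \<times> UNIV \<times> UNIV"
    by (rule list_congruence_tensor3_eq)
  have zero2: "?R [(a, 0, c)] []" if "a \<in> A" for a c
  proof -
    have "?R [(a, sb 0 0, c)] [(sa 0 a, 0, c)]"
      by (rule sym, rule tensor3_eq.scale12) (use that in auto)
    moreover have "?R [(0, 0, c)] []" by (rule tensor3_eq.zero) simp_all
    ultimately show ?thesis using trans by fastforce
  qed
  have zero3: "?R [(a, b, 0)] []" if "a \<in> A" for a b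
  proof -
    have "?R [(a, b, sb 0 0)] [(a, sb 0 b, 0)]"
      by (rule sym, rule tensor3_eq.scale23) (use that in auto)
    then show ?thesis using zero2[OF that, of 0] trans by fastforce
  qed
  have expand2: "?R [(a, \<Sum>d\<leftarrow>ds. sb (k d) d, c)] (concat (map (\<lambda>d. [(sa (k d) a, d, c)]) ds))"
    if a: "a \<in> A" for a c ds k
  proof (induction ds)
    case Nil
    then show ?case using zero2[OF a] by simp
  next
    case (Cons d ds)
    have "?R [(a, sb (k d) d + (\<Sum>d\<leftarrow>ds. sb (k d) d), c)]
        ([(a, sb (k d) d, c)] @ [(a, \<Sum>d\<leftarrow>ds. sb (k d) d, c)])"
      using tensor3_eq.add2[OF a UNIV_I UNIV_I UNIV_I] by simp
    also have "?R \<dots> ([(sa (k d) a, d, c)] @ concat (map (\<lambda>d. [(sa (k d) a, d, c)]) ds))"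
      by (intro append sym[OF tensor3_eq.scale12] Cons.IH a UNIV_I)
    finally show ?case by simp
  qed
  have expand3: "?R [(a, b, \<Sum>d\<leftarrow>ds. sb (k d) d)] (concat (map (\<lambda>d. [(sa (k d) a, b, d)]) ds))"
    if a: "a \<in> A" for a b ds k
  proof (induction ds)
    case Nil
    then show ?case using zero3[OF a] by simp
  next
    case (Cons d ds)
    have "?R [(a, b, sb (k d) d + (\<Sum>d\<leftarrow>ds. sb (k d) d))]
        ([(a, b, sb (k d) d)] @ [(a, b, \<Sum>d\<leftarrow>ds. sb (k d) d)])"
      using tensor3_eq.add3[OF a UNIV_I UNIV_I UNIV_I] by simp
    also have "?R \<dots> ([(sa (k d) a, b, d)] @ concat (map (\<lambda>d. [(sa (k d) a, b, d)]) ds))"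
    proof (intro append Cons.IH)
      have "?R [(a, b, sb (k d) d)] [(a, sb (k d) b, d)]"
        by (rule sym, rule tensor3_eq.scale23) (use a in auto)
      also have "?R \<dots> [(sa (k d) a, b, d)]"
        by (rule sym, rule tensor3_eq.scale12) (use a in auto)
      finally show "?R [(a, b, sb (k d) d)] [(sa (k d) a, b, d)]" .
    qed
    finally show ?case by simp
  qed
  have expand: "?R [(a, \<Sum>d\<leftarrow>cs. sb (k d) d, \<Sum>d\<leftarrow>cs. sb (l d) d)]
      (concat (map (\<lambda>(p, q). [(sa (k p * l q) a, p, q)]) (List.product ds cs)))"
    if "ds = cs" and a: "a \<in> A" for a k l ds
  proof -
    have "?R [(a, \<Sum>d\<leftarrow>ds. sb (k d) d, \<Sum>d\<leftarrow>cs. sb (l d) d)]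
        (concat (map (\<lambda>p. [(sa (k p) a, p, \<Sum>d\<leftarrow>cs. sb (l d) d)]) ds))"
      by (rule expand2[OF a])
    also have "?R \<dots> (concat (map (\<lambda>p. concat (map (\<lambda>q. [(sa (l q) (sa (k p) a), p, q)]) cs)) ds))"
      by (intro concat_cong expand3) (use a a.subspace_scale[OF A] in auto)
    also have "concat (map (\<lambda>p. concat (map (\<lambda>q. [(sa (l q) (sa (k p) a), p, q)]) cs)) ds) =
        concat (map (\<lambda>(p, q). [(sa (k p * l q) a, p, q)]) (List.product ds cs))"
      by (induction ds) (simp_all add: o_def mult.commute)
    finally show ?thesis using that(1) by simp
  qed
  have merge: "?R (concat (map (\<lambda>x. [(u x, b, c)]) ys)) [(\<Sum>x\<leftarrow>ys. u x, b, c)]"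
    if "\<And>y. y \<in> set ys \<Longrightarrow> u y \<in> A" for u :: "'a \<times> 'c \<times> 'c \<Rightarrow> 'a" and b c ys
    using that
  proof (induction ys)
    case Nil
    then show ?case using sym[OF tensor3_eq.zero[of b UNIV c]] by simp
  next
    case (Cons y ys)
    have "?R ([(u y, b, c)] @ concat (map (\<lambda>x. [(u x, b, c)]) ys)) ([(u y, b, c)] @ [(\<Sum>x\<leftarrow>ys. u x, b, c)])"
    proof (rule append)
      show "?R [(u y, b, c)] [(u y, b, c)]" by (rule refl) (simp add: Cons.prems)
      show "?R (concat (map (\<lambda>x. [(u x, b, c)]) ys)) [(\<Sum>x\<leftarrow>ys. u x, b, c)]"
        by (rule Cons.IH) (simp add: Cons.prems)
    qed
    also have "?R \<dots> [(u y + (\<Sum>x\<leftarrow>ys. u x), b, c)]"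
      using subspace_sum_list[OF sa A, of ys u] Cons.prems
      by (simp add: sym[OF tensor3_eq.add1])
    finally show ?case by simp
  qed
  let ?f = "\<lambda>(a, b, c) (p, q). [(sa (e p b * e q c) a, p, q)]"
  show ?thesis
  proof (rule collect_coordinates[where f = ?f])
    fix x assume mem: "x \<in> set xs"
    obtain a b c where abc: "x = (a, b, c)" by (cases x)
    then have x: "x = (a, b, c)" "a \<in> A"
        "b = (\<Sum>d\<leftarrow>cs. sb (e d b) d)" "c = (\<Sum>d\<leftarrow>cs. sb (e d c) d)"
      using xs mem cs[of a b c] by auto
    show "?R [x] (concat (map (?f x) (List.product cs cs)))"
      using expand[OF HOL.refl x(2), where k = "\<lambda>d. e d b" and l = "\<lambda>d. e d c"] x by simp
  next
    fix x pq assume "x \<in> set xs"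
    then show "set (?f x pq) \<subseteq> A \<times> UNIV \<times> UNIV"
      using xs a.subspace_scale[OF A] by (cases x, cases pq) auto
  next
    fix pq :: "'c \<times> 'c"
    obtain p q where pq: "pq = (p, q)" by (cases pq)
    have "?R (concat (map (\<lambda>x. [(case x of (a, b, c) \<Rightarrow> sa (e p b * e q c) a, p, q)]) xs))
        [(\<Sum>x\<leftarrow>xs. (case x of (a, b, c) \<Rightarrow> sa (e p b * e q c) a), p, q)]"
      by (rule merge) (use xs a.subspace_scale[OF A] in auto)
    moreover have "(\<lambda>x. ?f x pq) = (\<lambda>x. [(case x of (a, b, c) \<Rightarrow> sa (e p b * e q c) a, p, q)])"
      by (auto simp: fun_eq_iff pq)
    ultimately show "?R (concat (map (\<lambda>x. ?f x pq) xs))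
        [case pq of (p, q) \<Rightarrow> (\<Sum>(a, b, c)\<leftarrow>xs. sa (e p b * e q c) a, p, q)]"
      by (simp add: pq)
  qed
qed

text \<open>
  Functionals on the second factor separate tensors: the coordinates in a normal form are such
  functionals. By this and its threefold analogue, the identities between tensors in the comodule axioms
  become identities between vectors.
\<close>

lemma tensor_eq_if_functionals_eq:
  assumes sa: "vector_space sa" and sb: "vector_space sb" and A: "module.subspace sa A"
    and xs: "set xs \<subseteq> A \<times> UNIV" and ys: "set ys \<subseteq> A \<times> UNIV"
    and eq: "\<And>f. Vector_Spaces.linear sb (*) f \<Longrightarrow>
      (\<Sum>(a, b)\<leftarrow>xs. sa (f b) a) = (\<Sum>(a, b)\<leftarrow>ys. sa (f b) a)"
  shows "tensor_eq sa sb A UNIV xs ys"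
proof -
  interpret b: vector_space sb by fact
  define F where "F = snd ` (set xs \<union> set ys)"
  have "finite F" by (simp add: F_def)
  then obtain bs e where e: "\<And>b. Vector_Spaces.linear sb (*) (e b)"
      "\<And>x. x \<in> b.span F \<Longrightarrow> x = (\<Sum>b\<leftarrow>bs. sb (e b x) b)"
    using b.finite_coordinates by meson
  \<comment> \<open>One list \<open>bs\<close> serves both tensors, so that their normal forms can be compared entry by entry.\<close>
  have bF: "b = (\<Sum>c\<leftarrow>bs. sb (e c b) c)" if "(a, b) \<in> set xs \<union> set ys" for a b
    using that by (intro e(2) b.span_base) (force simp: F_def)
  have "tensor_eq sa sb A UNIV xs (map (\<lambda>c. (\<Sum>(a, b)\<leftarrow>xs. sa (e c b) a, c)) bs)"
    by (rule tensor_eq_coordinates[OF sa sb A xs]) (rule bF, rule UnI1)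
  also have "map (\<lambda>c. (\<Sum>(a, b)\<leftarrow>xs. sa (e c b) a, c)) bs = map (\<lambda>c. (\<Sum>(a, b)\<leftarrow>ys. sa (e c b) a, c)) bs"
    using eq[OF e(1)] by simp
  finally have 1: "tensor_eq sa sb A UNIV xs \<dots>" .
  have 2: "tensor_eq sa sb A UNIV ys (map (\<lambda>c. (\<Sum>(a, b)\<leftarrow>ys. sa (e c b) a, c)) bs)"
    by (rule tensor_eq_coordinates[OF sa sb A ys]) (rule bF, rule UnI2)
  show ?thesis by (rule tensor_eq.trans[OF 1 tensor_eq.sym[OF 2]])
qed

lemma tensor3_eq_if_functionals_eq:
  assumes sa: "vector_space sa" and sb: "vector_space sb" and A: "module.subspace sa A"
    and xs: "set xs \<subseteq> A \<times> UNIV" and ys: "set ys \<subseteq> A \<times> UNIV"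
    and eq: "\<And>f g. Vector_Spaces.linear sb (*) f \<Longrightarrow> Vector_Spaces.linear sb (*) g \<Longrightarrow>
      (\<Sum>(a, b, c)\<leftarrow>xs. sa (f b * g c) a) = (\<Sum>(a, b, c)\<leftarrow>ys. sa (f b * g c) a)"
  shows "tensor3_eq sa sb sb A UNIV UNIV xs ys"
proof -
  interpret b: vector_space sb by fact
  define F where "F = fst ` snd ` (set xs \<union> set ys) \<union> snd ` snd ` (set xs \<union> set ys)"
  have "finite F" by (simp add: F_def)
  then obtain bs e where e: "\<And>b. Vector_Spaces.linear sb (*) (e b)"
      "\<And>x. x \<in> b.span F \<Longrightarrow> x = (\<Sum>b\<leftarrow>bs. sb (e b x) b)"
    using b.finite_coordinates by meson
  have bF: "b = (\<Sum>d\<leftarrow>bs. sb (e d b) d) \<and> c = (\<Sum>d\<leftarrow>bs. sb (e d c) d)"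
    if "(a, b, c) \<in> set xs \<union> set ys" for a b c
  proof -
    have "b \<in> F" "c \<in> F" using that by (force simp: F_def)+
    then show ?thesis using e(2) b.span_base by blast
  qed
  let ?n = "\<lambda>zs. map (\<lambda>(p, q). (\<Sum>(a, b, c)\<leftarrow>zs. sa (e p b * e q c) a, p, q)) (List.product bs bs)"
  have "tensor3_eq sa sb sb A UNIV UNIV xs (?n xs)"
    by (rule tensor3_eq_coordinates[OF sa sb A xs]) (rule bF, rule UnI1)
  also have "?n xs = ?n ys"
    using eq[OF e(1) e(1)] by simp
  finally have 1: "tensor3_eq sa sb sb A UNIV UNIV xs (?n ys)" .
  have 2: "tensor3_eq sa sb sb A UNIV UNIV ys (?n ys)"
    by (rule tensor3_eq_coordinates[OF sa sb A ys]) (rule bF, rule UnI2)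
  show ?thesis by (rule tensor3_eq.trans[OF 1 tensor3_eq.sym[OF 2]])
qed

section \<open>The dual algebra and its two actions on the coalgebra\<close>

lemma sum_list_concat_map: "(\<Sum>x\<leftarrow>concat (map g xs). f x) = (\<Sum>y\<leftarrow>xs. \<Sum>x\<leftarrow>g y. f x)"
  by (induction xs) simp_all

context coalgebra
begin

lemma dualI:
  assumes "\<And>x y. f (x + y) = f x + f y" "\<And>k x. f (scale k x) = k * f x"
  shows "f \<in> dual"
  using assms vector_space_axioms
  by (auto simp: dual_def Vector_Spaces.linear_iff vector_space_def algebra_simps)

lemma
  assumes "f \<in> dual"
  shows dual_add: "f (x + y) = f x + f y" and dual_scale: "f (scale k x) = k * f x"
    and dual_0: "f 0 = 0"
proof -
  interpret f: Vector_Spaces.linear scale "(*)" f using assms by (simp add: dual_def)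
  show "f (x + y) = f x + f y" "f (scale k x) = k * f x" "f 0 = 0"
    by (simp_all add: f.add f.scale)
qed

lemma dual_sum_list: "f \<in> dual \<Longrightarrow> f (\<Sum>x\<leftarrow>xs. g x) = (\<Sum>x\<leftarrow>xs. f (g x))"
  by (induction xs) (simp_all add: dual_0 dual_add)

lemma eq_if_dual_eq: "(\<And>f. f \<in> dual \<Longrightarrow> f x = f y) \<Longrightarrow> x = y"
  by (rule eq_if_functionals_eq) (simp add: dual_def)

lemma counit_dual [simp]: "\<epsilon> \<in> dual"
  using counit_linear by (simp add: dual_def)

lemma zero_dual [simp]: "(\<lambda>c. 0) \<in> dual"
  by (rule dualI) simp_all

lemma add_dual [simp]: "f \<in> dual \<Longrightarrow> g \<in> dual \<Longrightarrow> (\<lambda>c. f c + g c) \<in> dual"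
  by (rule dualI) (simp_all add: dual_add dual_scale algebra_simps)

lemma diff_dual [simp]: "f \<in> dual \<Longrightarrow> g \<in> dual \<Longrightarrow> (\<lambda>c. f c - g c) \<in> dual"
  by (rule dualI) (simp_all add: dual_add dual_scale algebra_simps)

lemma scale_dual [simp]: "f \<in> dual \<Longrightarrow> (\<lambda>c. k * f c) \<in> dual"
  by (rule dualI) (simp_all add: dual_add dual_scale algebra_simps)

lemma sum_list_dual [simp]:
  "(\<And>x. x \<in> set xs \<Longrightarrow> f x \<in> dual) \<Longrightarrow> (\<lambda>c. \<Sum>x\<leftarrow>xs. f x c) \<in> dual"
  by (induction xs) simp_all

lemma comult_add_sum:
  fixes \<beta> :: "'c \<Rightarrow> 'c \<Rightarrow> 'd::ab_group_add"
  assumes "\<And>a a' b. \<beta> (a + a') b = \<beta> a b + \<beta> a' b" "\<And>a b b'. \<beta> a (b + b') = \<beta> a b + \<beta> a b'"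
    and "\<And>k a b. \<beta> (scale k a) b = \<beta> a (scale k b)"
  shows "(\<Sum>(a, b)\<leftarrow>\<Delta> (x + y). \<beta> a b) = (\<Sum>(a, b)\<leftarrow>\<Delta> x. \<beta> a b) + (\<Sum>(a, b)\<leftarrow>\<Delta> y. \<beta> a b)"
  using tensor_eq_sum[OF comult_add, of \<beta>] assms by simp

lemma comult_scale_sum:
  fixes \<beta> :: "'c \<Rightarrow> 'c \<Rightarrow> 'd::ab_group_add"
  assumes "\<And>a a' b. \<beta> (a + a') b = \<beta> a b + \<beta> a' b" "\<And>a b b'. \<beta> a (b + b') = \<beta> a b + \<beta> a b'"
    and "\<And>k a b. \<beta> (scale k a) b = \<beta> a (scale k b)"
  shows "(\<Sum>(a, b)\<leftarrow>\<Delta> (scale k x). \<beta> a b) = (\<Sum>(a, b)\<leftarrow>\<Delta> x. \<beta> (scale k a) b)"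
proof -
  have "(\<Sum>(a, b)\<leftarrow>\<Delta> (scale k x). \<beta> a b) = (\<Sum>(a, b)\<leftarrow>map (\<lambda>(a, b). (scale k a, b)) (\<Delta> x). \<beta> a b)"
    using tensor_eq_sum[OF comult_scale, of \<beta>] assms by simp
  then show ?thesis by (simp add: o_def case_prod_unfold)
qed

lemma coassoc_sum:
  fixes \<beta> :: "'c \<Rightarrow> 'c \<Rightarrow> 'c \<Rightarrow> 'd::ab_group_add"
  assumes "\<And>a a' b c. \<beta> (a + a') b c = \<beta> a b c + \<beta> a' b c"
    and "\<And>a b b' c. \<beta> a (b + b') c = \<beta> a b c + \<beta> a b' c"
    and "\<And>a b c c'. \<beta> a b (c + c') = \<beta> a b c + \<beta> a b c'"
    and "\<And>k a b c. \<beta> (scale k a) b c = \<beta> a (scale k b) c"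
    and "\<And>k a b c. \<beta> a (scale k b) c = \<beta> a b (scale k c)"
  shows "(\<Sum>(a, b)\<leftarrow>\<Delta> x. \<Sum>(p, q)\<leftarrow>\<Delta> a. \<beta> p q b) = (\<Sum>(a, b)\<leftarrow>\<Delta> x. \<Sum>(p, q)\<leftarrow>\<Delta> b. \<beta> a p q)"
  using tensor3_eq_sum[OF coassoc[of x], of \<beta>, OF assms]
  by (simp add: sum_list_concat_map case_prod_unfold o_def)

text \<open>
  The coalgebra is a bimodule over its dual algebra. These are the operators
  \<open>f \<rightharpoonup> c = c\<^sub>1 f(c\<^sub>2)\<close> and
  \<open>c \<leftharpoonup> f = f(c\<^sub>1) c\<^sub>2\<close>. They turn the convolution product into composition:
  \<open>f \<rightharpoonup> (g \<rightharpoonup> c) = (f g) \<rightharpoonup> c\<close>.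
\<close>

definition left_hit :: "('c \<Rightarrow> 'k) \<Rightarrow> 'c \<Rightarrow> 'c" where
  "left_hit f c = (\<Sum>(a, b)\<leftarrow>\<Delta> c. scale (f b) a)"

definition right_hit :: "('c \<Rightarrow> 'k) \<Rightarrow> 'c \<Rightarrow> 'c" where
  "right_hit f c = (\<Sum>(a, b)\<leftarrow>\<Delta> c. scale (f a) b)"

lemma linearI:
  assumes "\<And>x y. f (x + y) = f x + f y" "\<And>k x. f (scale k x) = scale k (f x)"
  shows "Vector_Spaces.linear scale scale f"
  using assms vector_space_axioms by (auto simp: Vector_Spaces.linear_iff)

lemma left_hit_linear:
  assumes f: "f \<in> dual"
  shows "Vector_Spaces.linear scale scale (left_hit f)"
proof (rule linearI)
  note f_simps = dual_add[OF f] dual_scale[OF f] scale_left_distrib scale_right_distrib mult.commute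
  show "left_hit f (x + y) = left_hit f x + left_hit f y" for x y
    unfolding left_hit_def by (rule comult_add_sum) (simp_all add: f_simps)
  show "left_hit f (scale k x) = scale k (left_hit f x)" for k x
    unfolding left_hit_def scale_sum_list
    by (subst comult_scale_sum) (simp_all add: f_simps case_prod_unfold)
qed

lemma right_hit_linear:
  assumes f: "f \<in> dual"
  shows "Vector_Spaces.linear scale scale (right_hit f)"
proof (rule linearI)
  note f_simps = dual_add[OF f] dual_scale[OF f] scale_left_distrib scale_right_distrib mult.commute
  show "right_hit f (x + y) = right_hit f x + right_hit f y" for x y
    unfolding right_hit_def by (rule comult_add_sum) (simp_all add: f_simps)
  show "right_hit f (scale k x) = scale k (right_hit f x)" for k x
    unfolding right_hit_def scale_sum_list
    by (subst comult_scale_sum) (simp_all add: f_simps case_prod_unfold)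
qed

lemma
  assumes f: "f \<in> dual"
  shows left_hit_add: "left_hit f (x + y) = left_hit f x + left_hit f y"
    and left_hit_scale: "left_hit f (scale k x) = scale k (left_hit f x)"
    and left_hit_0: "left_hit f 0 = 0"
    and left_hit_diff: "left_hit f (x - y) = left_hit f x - left_hit f y"
proof -
  interpret f: Vector_Spaces.linear scale scale "left_hit f" by (rule left_hit_linear[OF f])
  show "left_hit f (x + y) = left_hit f x + left_hit f y"
    "left_hit f (scale k x) = scale k (left_hit f x)" "left_hit f 0 = 0"
    "left_hit f (x - y) = left_hit f x - left_hit f y"
    by (simp_all add: f.add f.scale f.diff)
qed

lemma
  assumes f: "f \<in> dual"
  shows right_hit_add: "right_hit f (x + y) = right_hit f x + right_hit f y"
    and right_hit_scale: "right_hit f (scale k x) = scale k (right_hit f x)"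
    and right_hit_0: "right_hit f 0 = 0"
    and right_hit_diff: "right_hit f (x - y) = right_hit f x - right_hit f y"
proof -
  interpret f: Vector_Spaces.linear scale scale "right_hit f" by (rule right_hit_linear[OF f])
  show "right_hit f (x + y) = right_hit f x + right_hit f y"
    "right_hit f (scale k x) = scale k (right_hit f x)" "right_hit f 0 = 0"
    "right_hit f (x - y) = right_hit f x - right_hit f y"
    by (simp_all add: f.add f.scale f.diff)
qed

lemma left_hit_sum_list: "f \<in> dual \<Longrightarrow> left_hit f (\<Sum>x\<leftarrow>xs. g x) = (\<Sum>x\<leftarrow>xs. left_hit f (g x))"
  by (induction xs) (simp_all add: left_hit_0 left_hit_add)

lemma right_hit_sum_list: "f \<in> dual \<Longrightarrow> right_hit f (\<Sum>x\<leftarrow>xs. g x) = (\<Sum>x\<leftarrow>xs. right_hit f (g x))"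
  by (induction xs) (simp_all add: right_hit_0 right_hit_add)

lemma conv_left_hit: "f \<in> dual \<Longrightarrow> conv f g c = f (left_hit g c)"
  by (simp add: conv_def left_hit_def dual_sum_list dual_scale case_prod_unfold mult.commute)

lemma conv_right_hit: "g \<in> dual \<Longrightarrow> conv f g c = g (right_hit f c)"
  by (simp add: conv_def right_hit_def dual_sum_list dual_scale case_prod_unfold)

lemma left_hit_counit [simp]: "left_hit \<epsilon> c = c"
  by (simp add: left_hit_def counit_right)

lemma right_hit_counit [simp]: "right_hit \<epsilon> c = c"
  by (simp add: right_hit_def counit_left)

lemma conv_counit_right [simp]: "f \<in> dual \<Longrightarrow> conv f \<epsilon> = f"
  by (rule ext) (simp add: conv_left_hit)

lemma conv_counit_left [simp]: "f \<in> dual \<Longrightarrow> conv \<epsilon> f = f"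
  by (rule ext) (simp add: conv_right_hit)

lemma counit_left_hit: "f \<in> dual \<Longrightarrow> \<epsilon> (left_hit f c) = f c"
  using conv_left_hit[of \<epsilon> f c] by simp

lemma counit_right_hit: "f \<in> dual \<Longrightarrow> \<epsilon> (right_hit f c) = f c"
  using conv_right_hit[of \<epsilon> f c] by simp

lemma conv_dual [simp]: "f \<in> dual \<Longrightarrow> g \<in> dual \<Longrightarrow> conv f g \<in> dual"
  by (rule dualI) (simp_all add: conv_left_hit left_hit_add left_hit_scale dual_add dual_scale)

lemma left_hit_conv:
  assumes f: "f \<in> dual" and g: "g \<in> dual"
  shows "left_hit (conv f g) x = left_hit f (left_hit g x)"
proof -
  have "left_hit f (left_hit g x) = (\<Sum>(a, b)\<leftarrow>\<Delta> x. \<Sum>(p, q)\<leftarrow>\<Delta> a. scale (f q * g b) p)"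
    by (simp add: left_hit_def[of g] left_hit_sum_list[OF f] left_hit_scale[OF f] case_prod_unfold)
      (simp add: left_hit_def scale_sum_list case_prod_unfold mult.commute)
  also have "\<dots> = (\<Sum>(a, b)\<leftarrow>\<Delta> x. \<Sum>(p, q)\<leftarrow>\<Delta> b. scale (f p * g q) a)"
    by (rule coassoc_sum[of "\<lambda>p q b. scale (f q * g b) p"])
      (simp_all add: dual_add[OF f] dual_add[OF g] dual_scale[OF f] dual_scale[OF g]
        scale_left_distrib scale_right_distrib algebra_simps)
  also have "\<dots> = left_hit (conv f g) x"
    by (simp add: left_hit_def conv_def sum_list_scale case_prod_unfold)
  finally show ?thesis by simp
qed

lemma hit_commute:
  assumes f: "f \<in> dual" and g: "g \<in> dual"
  shows "left_hit f (right_hit g x) = right_hit g (left_hit f x)"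
proof -
  have "right_hit g (left_hit f x) = (\<Sum>(a, b)\<leftarrow>\<Delta> x. \<Sum>(p, q)\<leftarrow>\<Delta> a. scale (g p * f b) q)"
    by (simp add: left_hit_def right_hit_sum_list[OF g] right_hit_scale[OF g] case_prod_unfold)
      (simp add: right_hit_def scale_sum_list case_prod_unfold mult.commute)
  also have "\<dots> = (\<Sum>(a, b)\<leftarrow>\<Delta> x. \<Sum>(p, q)\<leftarrow>\<Delta> b. scale (g a * f q) p)"
    by (rule coassoc_sum[of "\<lambda>p q b. scale (g p * f b) q"])
      (simp_all add: dual_add[OF f] dual_add[OF g] dual_scale[OF f] dual_scale[OF g]
        scale_left_distrib scale_right_distrib algebra_simps)
  also have "\<dots> = left_hit f (right_hit g x)"
    by (simp add: right_hit_def left_hit_sum_list[OF f] left_hit_scale[OF f] case_prod_unfold)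
      (simp add: left_hit_def scale_sum_list case_prod_unfold)
  finally show ?thesis by simp
qed

lemma conv_assoc:
  assumes "f \<in> dual" "g \<in> dual" "h \<in> dual"
  shows "conv (conv f g) h = conv f (conv g h)"
  using assms by (simp add: fun_eq_iff conv_left_hit left_hit_conv)

text \<open>
  Functionals separate points, so this is associativity of the convolution product.
\<close>

lemma right_hit_conv:
  assumes f: "f \<in> dual" and g: "g \<in> dual"
  shows "right_hit (conv f g) x = right_hit g (right_hit f x)"
proof (rule eq_if_dual_eq)
  fix h assume h: "h \<in> dual"
  have "h (right_hit (conv f g) x) = conv (conv f g) h x"
    using h by (simp add: conv_right_hit)
  also have "\<dots> = conv g h (right_hit f x)"
    using f g h by (simp add: conv_assoc conv_right_hit[of "conv g h" f])
  finally show "h (right_hit (conv f g) x) = h (right_hit g (right_hit f x))"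
    using h by (simp add: conv_right_hit)
qed

lemma conv_scale_left: "conv (\<lambda>c. k * f c) g = (\<lambda>c. k * conv f g c)"
  by (simp add: conv_def case_prod_unfold algebra_simps sum_list_const_mult)

lemma conv_scale_right: "conv f (\<lambda>c. k * g c) = (\<lambda>c. k * conv f g c)"
  by (simp add: conv_def case_prod_unfold algebra_simps sum_list_const_mult)

text \<open>
  A functional \<open>g\<close> factors through a linear operator iff it vanishes on the kernel of the operator. This
  translates divisibility in the dual algebra into inclusions of subspaces of the coalgebra.
\<close>

lemma right_multiple_iff:
  assumes f: "f \<in> dual" and g: "g \<in> dual"
  shows "(\<exists>h\<in>dual. g = conv h f) \<longleftrightarrow> (\<forall>x. left_hit f x = 0 \<longrightarrow> g x = 0)"
proof
  assume "\<exists>h\<in>dual. g = conv h f"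
  then show "\<forall>x. left_hit f x = 0 \<longrightarrow> g x = 0" by (auto simp: conv_left_hit dual_0)
next
  assume "\<forall>x. left_hit f x = 0 \<longrightarrow> g x = 0"
  then obtain h where "h \<in> dual" "\<forall>x. g x = h (left_hit f x)"
    using linear_factor_through[OF left_hit_linear[OF f], of g] g by (auto simp: dual_def)
  then have "h \<in> dual \<and> g = conv h f" by (auto simp: conv_left_hit)
  then show "\<exists>h\<in>dual. g = conv h f" by blast
qed

lemma left_multiple_iff:
  assumes f: "f \<in> dual" and g: "g \<in> dual"
  shows "(\<exists>h\<in>dual. g = conv f h) \<longleftrightarrow> (\<forall>x. right_hit f x = 0 \<longrightarrow> g x = 0)"
proof
  assume "\<exists>h\<in>dual. g = conv f h"
  then show "\<forall>x. right_hit f x = 0 \<longrightarrow> g x = 0" by (auto simp: conv_right_hit dual_0)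
next
  assume "\<forall>x. right_hit f x = 0 \<longrightarrow> g x = 0"
  then obtain h where "h \<in> dual" "\<forall>x. g x = h (right_hit f x)"
    using linear_factor_through[OF right_hit_linear[OF f], of g] g by (auto simp: dual_def)
  then have "h \<in> dual \<and> g = conv f h" by (auto simp: conv_right_hit)
  then show "\<exists>h\<in>dual. g = conv f h" by blast
qed

section \<open>Subspaces stable under the right action\<close>

text \<open>
  The submodules of the coalgebra for the right action of the dual algebra: the left subcomodules,
  expressed without tensors.
\<close>

definition stable :: "'c set \<Rightarrow> bool" where
  "stable D \<longleftrightarrow> subspace D \<and> (\<forall>f\<in>dual. \<forall>d\<in>D. right_hit f d \<in> D)"

text \<open>
  If the first factors of \<open>\<Delta> d\<close> are expanded in a basis, the second factors become elements of the
  form \<open>d \<leftharpoonup> e\<close>, with \<open>e\<close> a coordinate functional, and these lie in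
  \<open>D\<close>.
\<close>

lemma stable_imp_left_subcomodule:
  assumes "stable D"
  shows "left_subcomodule D"
  unfolding left_subcomodule_def
proof (intro conjI ballI)
  show "subspace D" using assms by (simp add: stable_def)
  fix d assume d: "d \<in> D"
  let ?xs = "map prod.swap (\<Delta> d)"
  obtain bs e where e: "\<And>b. e b \<in> dual"
      "\<And>x. x \<in> span (set (map snd ?xs)) \<Longrightarrow> x = (\<Sum>b\<leftarrow>bs. scale (e b x) b)"
    using finite_coordinates[of "set (map snd ?xs)"] unfolding dual_def mem_Collect_eq by blast
  let ?ys = "map (\<lambda>c. (\<Sum>(a, b)\<leftarrow>?xs. scale (e c b) a, c)) bs"
  have "tensor_eq scale scale UNIV UNIV ?xs ?ys"
  proof (rule tensor_eq_coordinates)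
    fix a b assume "(a, b) \<in> set ?xs"
    then have "b \<in> set (map snd ?xs)" by force
    then show "b = (\<Sum>c\<leftarrow>bs. scale (e c b) c)" using e(2) span_base by blast
  qed (use vector_space_axioms in simp_all)
  then have "tensor_eq scale scale UNIV UNIV (\<Delta> d) (map prod.swap ?ys)"
    using tensor_eq_swap[of scale scale UNIV UNIV ?xs ?ys] vector_space_axioms by (simp add: o_def)
  moreover have "(\<Sum>(a, b)\<leftarrow>?xs. scale (e c b) a) = right_hit (e c) d" for c
    by (simp add: right_hit_def o_def case_prod_unfold)
  then have "set (map prod.swap ?ys) \<subseteq> UNIV \<times> D"
    using assms d e(1) by (auto simp: stable_def)
  ultimately show "\<exists>xs. set xs \<subseteq> UNIV \<times> D \<and> tensor_eq scale scale UNIV UNIV (\<Delta> d) xs"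
    by blast
qed

lemma stable_zero: "stable {0}"
  by (simp add: stable_def right_hit_0)

lemma stable_kernel:
  assumes f: "f \<in> dual"
  shows "stable {x. left_hit f x = 0}"
  using subspace_def left_hit_add[OF f] left_hit_scale[OF f] left_hit_0[OF f]
  by (auto simp: stable_def hit_commute[OF f] right_hit_0)

lemma stable_image:
  assumes f: "f \<in> dual" and D: "stable D"
  shows "stable (left_hit f ` D)"
proof -
  interpret f: Vector_Spaces.linear scale scale "left_hit f" by (rule left_hit_linear[OF f])
  show ?thesis
    using D f.subspace_image by (auto simp: stable_def hit_commute[OF f, symmetric])
qed

lemma stable_vimage:
  assumes f: "f \<in> dual" and D: "stable D"
  shows "stable {x. left_hit f x \<in> D}"
proof -
  interpret f: Vector_Spaces.linear scale scale "left_hit f" by (rule left_hit_linear[OF f])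
  show ?thesis
    using D f.subspace_linear_preimage by (auto simp: stable_def hit_commute[OF f])
qed

text \<open>
  For every functional \<open>g\<close>, \<open>g(f \<rightharpoonup> d) = f(d \<leftharpoonup> g)\<close> and
  \<open>d \<leftharpoonup> g\<close> stays in \<open>D\<close>.
\<close>

lemma left_hit_zero_if_stable:
  assumes f: "f \<in> dual" and D: "stable D" "\<And>d. d \<in> D \<Longrightarrow> f d = 0" and d: "d \<in> D"
  shows "left_hit f d = 0"
proof (rule eq_if_dual_eq)
  fix g assume g: "g \<in> dual"
  have "g (left_hit f d) = f (right_hit g d)"
    using f g by (simp add: conv_left_hit[symmetric] conv_right_hit)
  then show "g (left_hit f d) = g 0"
    using D d g by (simp add: stable_def dual_0)
qed

definition orbit :: "'c \<Rightarrow> 'c set" where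
  "orbit c = (\<lambda>f. right_hit f c) ` dual"

lemma orbit_base: "c \<in> orbit c"
  unfolding orbit_def by (rule image_eqI[of _ _ \<epsilon>]) simp_all

lemma orbit_least: "stable D \<Longrightarrow> c \<in> D \<Longrightarrow> orbit c \<subseteq> D"
  by (auto simp: orbit_def stable_def)

lemma stable_orbit: "stable (orbit c)"
  unfolding stable_def
proof (intro conjI ballI)
  show "subspace (orbit c)"
  proof (rule subspaceI)
    have "0 = right_hit (\<lambda>_. 0) c" by (simp add: right_hit_def case_prod_unfold)
    then show "0 \<in> orbit c" unfolding orbit_def using zero_dual by blast
  next
    fix x y assume "x \<in> orbit c" "y \<in> orbit c"
    then obtain f g where fg: "f \<in> dual" "x = right_hit f c" "g \<in> dual" "y = right_hit g c"
      by (auto simp: orbit_def)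
    then have "x + y = right_hit (\<lambda>d. f d + g d) c"
      by (simp add: right_hit_def case_prod_unfold scale_left_distrib sum_list_addf)
    then show "x + y \<in> orbit c" unfolding orbit_def using add_dual[OF fg(1,3)] by blast
  next
    fix k x assume "x \<in> orbit c"
    then obtain f where f: "f \<in> dual" "x = right_hit f c" by (auto simp: orbit_def)
    then have "scale k x = right_hit (\<lambda>d. k * f d) c"
      by (simp add: right_hit_def case_prod_unfold scale_sum_list)
    then show "scale k x \<in> orbit c" unfolding orbit_def using scale_dual[OF f(1)] by blast
  qed
  show "right_hit f d \<in> orbit c" if "f \<in> dual" "d \<in> orbit c" for f d
    using that by (auto simp: orbit_def right_hit_conv[symmetric])
qed

text \<open>
  The fundamental finiteness property of coalgebras: \<open>c \<leftharpoonup> f\<close> is a combination of the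
  second factors of \<open>\<Delta> c\<close>.
\<close>

lemma orbit_finite_span: "\<exists>F. finite F \<and> orbit c \<subseteq> span F"
proof (intro exI conjI subsetI)
  show "finite (snd ` set (\<Delta> c))" by simp
  fix x assume "x \<in> orbit c"
  then obtain f where "x = (\<Sum>(a, b)\<leftarrow>\<Delta> c. scale (f a) b)"
    by (auto simp: orbit_def right_hit_def)
  then show "x \<in> span (snd ` set (\<Delta> c))"
    using subspace_sum_list[OF vector_space_axioms subspace_span,
        of "\<Delta> c" "\<lambda>(a, b). scale (f a) b" "snd ` set (\<Delta> c)"]
    by (force intro: span_scale span_base)
qed

end

section \<open>The uniformizer of a chain coalgebra\<close>

context chain_coalgebra
begin

lemma stable_chain: "stable D \<Longrightarrow> stable E \<Longrightarrow> D \<subseteq> E \<or> E \<subseteq> D"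
  using chain stable_imp_left_subcomodule by blast

text \<open>
  Take \<open>c\<close> outside \<open>P\<close> with orbit of least dimension. For any other \<open>d\<close> outside
  \<open>P\<close> the two orbits are comparable, and the orbit of \<open>d\<close> cannot be the smaller one. This
  yields the minimal left subcomodule (\<open>P = {0}\<close>) and the one that covers it (\<open>P = S\<close>).
\<close>

lemma exists_least_orbit:
  assumes "P \<noteq> UNIV"
  shows "\<exists>c. c \<notin> P \<and> (\<forall>E. stable E \<longrightarrow> \<not> E \<subseteq> P \<longrightarrow> orbit c \<subseteq> E)"
proof -
  have "\<exists>c. c \<notin> P" using assms by blast
  then obtain c where c: "c \<notin> P" "\<And>d. d \<notin> P \<Longrightarrow> dim (orbit c) \<le> dim (orbit d)"
    using ex_has_least_nat[of "\<lambda>c. c \<notin> P" _ "\<lambda>c. dim (orbit c)"] by blast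
  have "orbit c \<subseteq> E" if E: "stable E" "\<not> E \<subseteq> P" for E
  proof -
    obtain d where d: "d \<in> E" "d \<notin> P" using E(2) by blast
    have "\<not> orbit d \<subset> orbit c"
    proof
      assume less: "orbit d \<subset> orbit c"
      obtain F where F: "finite F" "orbit c \<subseteq> span F" using orbit_finite_span by blast
      have "dim (orbit d) < dim (orbit c)"
        using stable_orbit less F by (intro dim_strict_mono) (auto simp: stable_def)
      then show False using c(2)[OF d(2)] by simp
    qed
    then have "orbit c \<subseteq> orbit d" using stable_chain[OF stable_orbit stable_orbit, of c d] by blast
    then show ?thesis using orbit_least[OF E(1) d(1)] by blast
  qed
  then show ?thesis using c(1) by blast
qed

end

text \<open>
  For a nonzero coalgebra, \<open>S\<close> is the unique simple left subcomodule. The zero coalgebra is included with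
  \<open>S = {0}\<close>, and the last assumption says that this is the only case in which \<open>S\<close> is zero.
\<close>

locale chain_socle = chain_coalgebra scale \<Delta> \<epsilon>
  for scale :: "'k::field \<Rightarrow> 'c::ab_group_add \<Rightarrow> 'c" and \<Delta> and \<epsilon> +
  fixes S :: "'c set"
  assumes S_stable: "stable S"
    and S_finite: "\<exists>F. finite F \<and> S \<subseteq> span F"
    and S_least: "stable E \<Longrightarrow> E \<noteq> {0} \<Longrightarrow> S \<subseteq> E"
    and S_nonzero: "S = {0} \<Longrightarrow> (x :: 'c) = 0"

lemma (in chain_coalgebra) exists_socle: "\<exists>S. chain_socle scale \<Delta> \<epsilon> S"
proof (cases "(UNIV :: 'b set) = {0}")
  case True
  then have "x = 0" for x :: 'b by blast
  then have "chain_socle scale \<Delta> \<epsilon> {0}"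
    by unfold_locales (auto simp: stable_zero stable_def subspace_0 intro: exI[of _ "{}"])
  then show ?thesis by blast
next
  case False
  then obtain c where c: "c \<noteq> 0" "\<And>E. stable E \<Longrightarrow> \<not> E \<subseteq> {0} \<Longrightarrow> orbit c \<subseteq> E"
    using exists_least_orbit[of "{0}"] by auto
  have "chain_socle scale \<Delta> \<epsilon> (orbit c)"
  proof unfold_locales
    show "orbit c \<subseteq> E" if "stable E" "E \<noteq> {0}" for E
      using that c(2) subspace_0[of E] by (auto simp: stable_def)
    show "x = 0" if "orbit c = {0}" for x using that c(1) orbit_base[of c] by simp
  qed (fact stable_orbit orbit_finite_span)+
  then show ?thesis by blast
qed

context chain_socle
begin

lemma S_subspace: "subspace S"
  using S_stable by (simp add: stable_def)

lemma S_subset_image: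
  assumes f: "f \<in> dual" and "s \<in> S" "left_hit f s \<noteq> 0" and D: "stable D" "S \<subseteq> D"
  shows "S \<subseteq> left_hit f ` D"
  using assms by (intro S_least stable_image) auto

text \<open>
  The kernel of \<open>f \<rightharpoonup> _\<close> is stable and does not contain \<open>S\<close>, so it is zero;
  hence \<open>\<epsilon>\<close> is a left multiple of \<open>f\<close>.
\<close>

lemma left_inverse_if_nonzero_on_S:
  assumes f: "f \<in> dual" and s: "s \<in> S" "f s \<noteq> 0"
  shows "\<exists>g\<in>dual. conv g f = \<epsilon>"
proof -
  have s': "left_hit f s \<noteq> 0" using counit_left_hit[OF f, of s] s by (auto simp: dual_0)
  have "x = 0" if "left_hit f x = 0" for x
  proof (rule ccontr)
    assume "x \<noteq> 0"
    then have "S \<subseteq> {x. left_hit f x = 0}"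
      using that by (intro S_least stable_kernel f) auto
    then show False using s(1) s' by blast
  qed
  then have "\<forall>x. left_hit f x = 0 \<longrightarrow> \<epsilon> x = 0" by (metis dual_0 counit_dual)
  then show ?thesis using right_multiple_iff[OF f counit_dual] by metis
qed

text \<open>
  \<open>g \<rightharpoonup> _\<close> undoes \<open>f \<rightharpoonup> _\<close>, which maps \<open>S\<close> onto a
  space that contains \<open>S\<close>; so \<open>g \<rightharpoonup> _\<close> cannot annihilate \<open>S\<close>.
\<close>

lemma left_inverse_nonzero_on_S:
  assumes f: "f \<in> dual" and s: "s \<in> S" "f s \<noteq> 0" and g: "g \<in> dual" "conv g f = \<epsilon>"
  shows "\<exists>u\<in>S. g u \<noteq> 0"
proof (rule ccontr)
  assume "\<not> (\<exists>u\<in>S. g u \<noteq> 0)"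
  then have g0: "left_hit g u = 0" if "u \<in> S" for u
    using left_hit_zero_if_stable[OF g(1) S_stable] that by blast
  have "left_hit f s \<noteq> 0" using counit_left_hit[OF f, of s] s by (auto simp: dual_0)
  then have "S \<subseteq> left_hit f ` S" using S_subset_image[OF f s(1) _ S_stable] by blast
  then obtain u where u: "u \<in> S" "s = left_hit f u" using s(1) by blast
  have "left_hit g s = u"
    using u(2) left_hit_conv[OF g(1) f, of u] g(2) by simp
  then have "s = 0" using g0[OF s(1)] u(2) left_hit_0[OF f] by simp
  then show False using s(2) dual_0[OF f] by simp
qed

text \<open>
  By the two preceding lemmas the left inverse has a left inverse itself, so it is two-sided.
\<close>

lemma invertible_if_nonzero_on_S:
  assumes f: "f \<in> dual" and s: "s \<in> S" "f s \<noteq> 0"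
  shows "\<exists>g\<in>dual. conv f g = \<epsilon> \<and> conv g f = \<epsilon>"
proof -
  obtain g where g: "g \<in> dual" "conv g f = \<epsilon>"
    using left_inverse_if_nonzero_on_S[OF f s] by blast
  then obtain h where h: "h \<in> dual" "conv h g = \<epsilon>"
    using left_inverse_nonzero_on_S[OF f s] left_inverse_if_nonzero_on_S by blast
  have "conv h (conv g f) = conv (conv h g) f"
    by (rule conv_assoc[OF h(1) g(1) f, symmetric])
  then have "h = f" by (simp only: g(2) h(2) conv_counit_left[OF f] conv_counit_right[OF h(1)])
  then show ?thesis using g h by blast
qed

text \<open>
  \<open>S\<close> is a subcoalgebra: either \<open>f \<rightharpoonup> _\<close> annihilates \<open>S\<close>, or
  \<open>f\<close> is a unit and, with \<open>g\<close> its inverse,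
  \<open>S \<subseteq> g \<rightharpoonup> S\<close> gives \<open>f \<rightharpoonup> S \<subseteq> S\<close>.
\<close>

lemma S_left_hit:
  assumes f: "f \<in> dual" and s: "s \<in> S"
  shows "left_hit f s \<in> S"
proof (cases "\<exists>u\<in>S. f u \<noteq> 0")
  case False
  then have "left_hit f s = 0" using left_hit_zero_if_stable[OF f S_stable _ s] by blast
  then show ?thesis using subspace_0[OF S_subspace] by simp
next
  case True
  then obtain g where g: "g \<in> dual" "conv f g = \<epsilon>" "conv g f = \<epsilon>"
    using invertible_if_nonzero_on_S[OF f] by blast
  have fg: "left_hit f (left_hit g x) = x" for x
    using left_hit_conv[OF f g(1), of x] g(2) by simp
  show ?thesis
  proof (cases "s = 0")
    case False
    then have "left_hit g s \<noteq> 0" using fg[of s] left_hit_0[OF f] by auto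
    then have "S \<subseteq> left_hit g ` S" using S_subset_image[OF g(1) s _ S_stable] by blast
    then show ?thesis using s fg by auto
  qed (use s left_hit_0[OF f] in simp)
qed

text \<open>
  \<open>S\<close> is also least among the nonzero subspaces stable under the left action. If \<open>g\<close>
  vanishes on such a subspace, which contains \<open>x \<noteq> 0\<close>, then
  \<open>x \<leftharpoonup> g = 0\<close>, so \<open>g\<close> is not a unit and vanishes on \<open>S\<close>.
\<close>

lemma S_least_left_stable:
  assumes E: "subspace E" "\<And>f x. f \<in> dual \<Longrightarrow> x \<in> E \<Longrightarrow> left_hit f x \<in> E"
    and x: "x \<in> E" "x \<noteq> 0"
  shows "S \<subseteq> E"
proof (rule subspace_eq_if_annihilated[OF E(1)])
  fix g assume "Vector_Spaces.linear scale (*) g" and g0: "\<forall>w\<in>E. g w = 0"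
  then have g: "g \<in> dual" by (simp add: dual_def)
  have gx: "right_hit g x = 0"
  proof (rule eq_if_dual_eq)
    fix f assume f: "f \<in> dual"
    have "f (right_hit g x) = g (left_hit f x)"
      using f g by (simp add: conv_left_hit[symmetric] conv_right_hit)
    then show "f (right_hit g x) = f 0" using f g0 E(2) x(1) by (simp add: dual_0)
  qed
  show "\<forall>v\<in>S. g v = 0"
  proof (rule ccontr)
    assume "\<not> (\<forall>v\<in>S. g v = 0)"
    then obtain h where h: "h \<in> dual" "conv g h = \<epsilon>"
      using invertible_if_nonzero_on_S[OF g] by blast
    then have "x = right_hit h (right_hit g x)"
      using right_hit_conv[OF g h(1), of x] by simp
    then show False using gx x(2) right_hit_0[OF h(1)] by simp
  qed
qed

end

text \<open>
  The condition on \<open>t\<close> means that its left multiples are exactly the functionals that vanish on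
  \<open>S\<close>.
\<close>

locale chain_uniformizer = chain_socle scale \<Delta> \<epsilon> S
  for scale :: "'k::field \<Rightarrow> 'c::ab_group_add \<Rightarrow> 'c" and \<Delta> and \<epsilon> and S +
  fixes t :: "'c \<Rightarrow> 'k"
  assumes t_dual [simp]: "t \<in> dual"
    and t_kernel: "left_hit t x = 0 \<longleftrightarrow> x \<in> S"

lemma (in chain_socle) exists_uniformizer: "\<exists>t. chain_uniformizer scale \<Delta> \<epsilon> S t"
proof (cases "S = UNIV")
  case True
  \<comment> \<open>Then the dual algebra is a division algebra or zero, and its only nonunits are multiples of \<open>0\<close>.\<close>
  have "chain_uniformizer scale \<Delta> \<epsilon> S (\<lambda>c. 0)"
    by unfold_locales (simp_all add: True left_hit_def case_prod_unfold)
  then show ?thesis by blast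
next
  case False
  then obtain c where c: "c \<notin> S" "\<And>E. stable E \<Longrightarrow> \<not> E \<subseteq> S \<Longrightarrow> orbit c \<subseteq> E"
    using exists_least_orbit by blast
  then obtain t where t: "t \<in> dual" "\<And>s. s \<in> S \<Longrightarrow> t s = 0" "t c \<noteq> 0"
    using functional_separates_subspace[OF S_subspace c(1)] by (auto simp: dual_def)
  have "left_hit t x = 0 \<longleftrightarrow> x \<in> S" for x
  proof
    show "left_hit t x = 0" if "x \<in> S"
      using left_hit_zero_if_stable[OF t(1) S_stable t(2) that] .
    have "left_hit t c \<noteq> 0" using t(3) counit_left_hit[OF t(1), of c] by (auto simp: dual_0)
    then have "{x. left_hit t x = 0} \<subseteq> S"
      using c(2)[OF stable_kernel[OF t(1)]] orbit_base[of c] by blast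
    then show "x \<in> S" if "left_hit t x = 0" using that by blast
  qed
  then have "chain_uniformizer scale \<Delta> \<epsilon> S t"
    using t(1) by unfold_locales
  then show ?thesis by blast
qed

context chain_uniformizer
begin

lemma t_zero_on_S: "s \<in> S \<Longrightarrow> t s = 0"
  using t_kernel[of s] counit_left_hit[of t s] by (simp add: dual_0)

lemma right_hit_t_zero_on_S:
  assumes s: "s \<in> S"
  shows "right_hit t s = 0"
proof (rule eq_if_dual_eq)
  fix f assume f: "f \<in> dual"
  have "f (right_hit t s) = t (left_hit f s)"
    using f by (simp add: conv_left_hit[symmetric] conv_right_hit)
  then show "f (right_hit t s) = f 0"
    using t_zero_on_S[OF S_left_hit[OF f s]] f by (simp add: dual_0)
qed

text \<open>
  A nonzero stable \<open>D\<close> contains \<open>S\<close>, which \<open>t \<rightharpoonup> _\<close> annihilates,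
  so \<open>t \<rightharpoonup> D\<close> has smaller dimension than \<open>D\<close>. It is again stable, and the
  argument can be repeated.
\<close>

lemma left_hit_t_nilpotent_on:
  assumes "finite F" "D \<subseteq> span F" "stable D"
  shows "\<exists>n. \<forall>x\<in>D. (left_hit t ^^ n) x = 0"
  using assms
proof (induction "card F" arbitrary: F D rule: less_induct)
  case less
  show ?case
  proof (cases "D = {0}")
    case True
    then show ?thesis by (intro exI[of _ 0]) simp
  next
    case False
    then have SD: "S \<subseteq> D" using S_least less.prems by blast
    obtain y where "y \<in> D" "y \<noteq> 0"
      using False subspace_0 less.prems(3) unfolding stable_def by blast
    then have "S \<noteq> {0}" using S_nonzero by blast
    then obtain s where s: "s \<in> S" "s \<noteq> 0" using subspace_0[OF S_subspace] by blast
    have "left_hit t s = 0" using s t_kernel by simp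
    then obtain G where G: "finite G" "card G < card F" "left_hit t ` D \<subseteq> span G"
      using image_spanned_by_fewer[OF left_hit_linear[OF t_dual], of D F s] less.prems s SD
      by (auto simp: stable_def)
    then obtain n where "\<forall>x\<in>left_hit t ` D. (left_hit t ^^ n) x = 0"
      using less.hyps[OF G(2,1,3)] stable_image[OF t_dual less.prems(3)] by blast
    then have "\<forall>x\<in>D. (left_hit t ^^ Suc n) x = 0"
      by (simp add: funpow_swap1)
    then show ?thesis by blast
  qed
qed

lemma left_hit_t_locally_nilpotent: "\<exists>n. (left_hit t ^^ n) c = 0"
  using left_hit_t_nilpotent_on[OF _ _ stable_orbit, of _ c] orbit_finite_span[of c] orbit_base[of c]
  by blast

text \<open>
  Suppose that the second layer \<open>C = {y. t \<rightharpoonup> y \<in> S}\<close> is larger than \<open>S\<close>.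
  Both \<open>t \<rightharpoonup> _\<close> and \<open>_ \<leftharpoonup> t\<close> map \<open>C\<close> onto
  \<open>S\<close>: their images are nonzero and stable on one side, and \<open>S\<close> is least on both sides. Both
  vanish on \<open>S\<close>, which is the whole kernel of the first map, so
  \<open>t \<rightharpoonup> y \<mapsto> y \<leftharpoonup> t\<close> is a well defined surjective endomorphism of
  \<open>S\<close>. It is injective because \<open>S\<close> has finite dimension, hence
  \<open>y \<leftharpoonup> t = 0\<close> forces \<open>t \<rightharpoonup> y = 0\<close>.
\<close>

lemma right_kernel_t_second_layer:
  assumes x: "left_hit t x \<in> S" "right_hit t x = 0"
  shows "x \<in> S"
proof (rule ccontr)
  assume "x \<notin> S"
  then have x0: "left_hit t x \<noteq> 0" using t_kernel by blast
  define C where "C = {y. left_hit t y \<in> S}"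
  have C: "stable C" unfolding C_def by (rule stable_vimage[OF t_dual S_stable])
  have C_left: "left_hit f y \<in> C" if f: "f \<in> dual" and y: "y \<in> C" for f y
  proof -
    \<comment> \<open>Being a two-sided ideal, the nonunits contain \<open>t f\<close>, which is therefore a left multiple of \<open>t\<close>.\<close>
    have "conv t f z = 0" if "left_hit t z = 0" for z
    proof -
      have "left_hit f z \<in> S" using that t_kernel S_left_hit[OF f] by blast
      then show ?thesis using t_zero_on_S by (simp add: conv_left_hit)
    qed
    then obtain g where g: "g \<in> dual" "conv t f = conv g t"
      using right_multiple_iff[OF t_dual, of "conv t f"] f by auto
    have "left_hit t (left_hit f y) = left_hit g (left_hit t y)"
      using left_hit_conv[OF t_dual f] left_hit_conv[OF g(1) t_dual] g(2) by metis
    then show ?thesis using y S_left_hit[OF g(1)] by (simp add: C_def)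
  qed
  have xC: "x \<in> C" using x by (simp add: C_def)
  have left_onto: "S \<subseteq> left_hit t ` C"
    using x0 xC by (intro S_least stable_image C t_dual) auto
  have right_onto: "S \<subseteq> right_hit t ` C"
  proof -
    have "\<exists>y\<in>C. t y \<noteq> 0"
      using left_hit_zero_if_stable[OF t_dual C _ xC] x0 by blast
    then obtain y where y: "y \<in> C" "t y \<noteq> 0" by blast
    have "right_hit t y \<noteq> 0" using counit_right_hit[OF t_dual, of y] y(2) by (auto simp: dual_0)
    moreover interpret r: Vector_Spaces.linear scale scale "right_hit t"
      by (rule right_hit_linear[OF t_dual])
    have "subspace (right_hit t ` C)" using C r.subspace_image by (simp add: stable_def)
    moreover have "left_hit f z \<in> right_hit t ` C" if f: "f \<in> dual" and z: "z \<in> right_hit t ` C" for f z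
      using z C_left[OF f] hit_commute[OF f t_dual] by auto
    ultimately show ?thesis using y(1) by (intro S_least_left_stable[of _ "right_hit t y"]) auto
  qed
  have right_into: "right_hit t y \<in> S" if "y \<in> C" for y
  proof -
    have "left_hit t (right_hit t y) = 0"
      using that right_hit_t_zero_on_S by (simp add: hit_commute C_def)
    then show ?thesis using t_kernel by blast
  qed
  interpret vector_space_pair scale scale
    using vector_space_axioms by (simp add: vector_space_pair_def)
  obtain r where r: "Vector_Spaces.linear scale scale r" "\<forall>v\<in>range (left_hit t). left_hit t (r v) = v"
    using linear_exists_right_inverse_on[OF left_hit_linear[OF t_dual] subspace_UNIV] by blast
  define \<phi> where "\<phi> = right_hit t \<circ> r"
  have \<phi>: "Vector_Spaces.linear scale scale \<phi>"
    unfolding \<phi>_def by (rule Vector_Spaces.linear_compose[OF r(1) right_hit_linear[OF t_dual]])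
  have \<phi>_left: "\<phi> (left_hit t y) = right_hit t y" for y
  proof -
    have "left_hit t (y - r (left_hit t y)) = 0" using r(2) by (simp add: left_hit_diff)
    then have "right_hit t (y - r (left_hit t y)) = 0"
      using t_kernel right_hit_t_zero_on_S by blast
    then show ?thesis by (simp add: right_hit_diff \<phi>_def)
  qed
  have "S \<subseteq> \<phi> ` S"
  proof
    fix v assume "v \<in> S"
    then obtain y where "y \<in> C" "v = right_hit t y" using right_onto by blast
    then show "v \<in> \<phi> ` S" using \<phi>_left[of y] by (intro image_eqI[of _ _ "left_hit t y"]) (auto simp: C_def)
  qed
  moreover obtain F where "finite F" "S \<subseteq> span F" using S_finite by blast
  moreover have "\<phi> (left_hit t x) = 0" using \<phi>_left x(2) by simp
  ultimately have "left_hit t x = 0"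
    using surjective_endomorphism_injective[OF \<phi> S_subspace] x(1) by blast
  then show False using x0 by simp
qed

lemma right_kernel_t: "right_hit t x = 0 \<longleftrightarrow> x \<in> S"
proof
  show "right_hit t x = 0" if "x \<in> S" using that by (rule right_hit_t_zero_on_S)
  \<comment> \<open>Descend along the layers: \<open>t \<rightharpoonup> x\<close> is again killed by \<open>_ \<leftharpoonup> t\<close>, since the two actions commute.\<close>
  have step: "x \<in> S" if "(left_hit t ^^ n) x = 0" "right_hit t x = 0" for n x
    using that
  proof (induction n arbitrary: x)
    case 0
    then show ?case using subspace_0[OF S_subspace] by simp
  next
    case (Suc n)
    have "left_hit t x \<in> S"
    proof (rule Suc.IH)
      show "(left_hit t ^^ n) (left_hit t x) = 0" using Suc.prems(1) by (simp add: funpow_swap1)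
      show "right_hit t (left_hit t x) = 0"
        using Suc.prems(2) hit_commute[OF t_dual t_dual, of x] by (simp add: left_hit_0)
    qed
    then show ?case using right_kernel_t_second_layer Suc.prems(2) by blast
  qed
  show "x \<in> S" if "right_hit t x = 0"
    using step[OF _ that] left_hit_t_locally_nilpotent[of x] by blast
qed

lemma multiple_of_t_iff:
  assumes f: "f \<in> dual"
  shows "(\<exists>g\<in>dual. f = conv t g) \<longleftrightarrow> (\<forall>s\<in>S. f s = 0)"
    and "(\<exists>g\<in>dual. f = conv g t) \<longleftrightarrow> (\<forall>s\<in>S. f s = 0)"
  using left_multiple_iff[OF t_dual f] right_multiple_iff[OF t_dual f]
  by (auto simp: right_kernel_t t_kernel)

lemma kernel_t_power_finite: "\<exists>F. finite F \<and> {x. (left_hit t ^^ n) x = 0} \<subseteq> span F"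
proof (induction n)
  case 0
  then show ?case by (intro exI[of _ "{}"]) auto
next
  case (Suc n)
  obtain F where F: "finite F" "S \<subseteq> span F" using S_finite by blast
  obtain G where G: "finite G" "{x. (left_hit t ^^ n) x = 0} \<subseteq> span G" using Suc.IH by blast
  have K: "{x. (left_hit t ^^ Suc n) x = 0} = {x. left_hit t x \<in> {x. (left_hit t ^^ n) x = 0}}"
    by (simp add: funpow_swap1)
  have sub: "stable {x. (left_hit t ^^ m) x = 0}" for m
  proof (induction m)
    case 0
    then show ?case using stable_zero by (simp add: singleton_conv)
  next
    case (Suc m)
    then show ?case using stable_vimage[OF t_dual Suc] by (simp add: funpow_swap1)
  qed
  have "\<exists>H. finite H \<and> {x. (left_hit t ^^ Suc n) x = 0} \<subseteq> span H"
  proof (rule finite_span_if_kernel_image[OF left_hit_linear[OF t_dual] _ F(1) _ G(1)])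
    show "subspace {x. (left_hit t ^^ Suc n) x = 0}" using sub[of "Suc n"] unfolding stable_def by blast
    show "x \<in> span F" if "left_hit t x = 0" for x using that t_kernel F(2) by blast
    show "left_hit t ` {x. (left_hit t ^^ Suc n) x = 0} \<subseteq> span G" using G(2) K by blast
  qed
  then show ?case .
qed

end


text \<open>
  The dual algebra as a complete discrete valuation ring with uniformizer \<open>t\<close>. In order: the ideals
  \<open>t A\<close> and \<open>A t\<close> agree, all elements outside them are units, \<open>A t\<^sup>n\<close>
  contains the annihilator of a finite set in the coalgebra, and each point of the coalgebra is annihilated by some
  \<open>A t\<^sup>n\<close>. Interchanging the two sides leaves these conditions invariant, whereas the chain
  condition refers to one side. A nilpotent \<open>t\<close> occurs when the coalgebra has finite dimension.
\<close>

locale uniformized_coalgebra = coalgebra scale \<Delta> \<epsilon>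
  for scale :: "'k::field \<Rightarrow> 'c::ab_group_add \<Rightarrow> 'c" and \<Delta> and \<epsilon> +
  fixes t :: "'c \<Rightarrow> 'k"
  assumes t_dual [simp]: "t \<in> dual"
    and t_normal: "f \<in> dual \<Longrightarrow> (\<exists>g\<in>dual. f = conv t g) \<longleftrightarrow> (\<exists>g\<in>dual. f = conv g t)"
    and unit_or_multiple: "f \<in> dual \<Longrightarrow>
      (\<exists>g\<in>dual. conv f g = \<epsilon> \<and> conv g f = \<epsilon>) \<or> (\<exists>g\<in>dual. f = conv t g)"
    and finite_codim: "\<exists>F. finite F \<and>
      (\<forall>f\<in>dual. (\<forall>x\<in>F. f x = 0) \<longrightarrow> (\<exists>g\<in>dual. f = conv g ((conv t ^^ n) \<epsilon>)))"
    and separated: "\<exists>n. \<forall>g\<in>dual. conv g ((conv t ^^ n) \<epsilon>) c = 0"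

lemma (in chain_uniformizer) uniformized: "uniformized_coalgebra scale \<Delta> \<epsilon> t"
proof unfold_locales
  have power: "(conv t ^^ n) \<epsilon> \<in> dual" "left_hit ((conv t ^^ n) \<epsilon>) x = (left_hit t ^^ n) x" for n x
  proof (induction n)
    case (Suc n)
    {
      case 1
      then show ?case using Suc by simp
    next
      case 2
      then show ?case using Suc by (simp add: left_hit_conv)
    }
  qed simp_all
  show "(\<exists>g\<in>dual. f = conv t g) \<longleftrightarrow> (\<exists>g\<in>dual. f = conv g t)" if "f \<in> dual" for f
    using multiple_of_t_iff[OF that] by simp
  show "(\<exists>g\<in>dual. conv f g = \<epsilon> \<and> conv g f = \<epsilon>) \<or> (\<exists>g\<in>dual. f = conv t g)" if "f \<in> dual" for f
    using multiple_of_t_iff(1)[OF that] invertible_if_nonzero_on_S[OF that] by blast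
  show "\<exists>F. finite F \<and> (\<forall>f\<in>dual. (\<forall>x\<in>F. f x = 0) \<longrightarrow> (\<exists>g\<in>dual. f = conv g ((conv t ^^ n) \<epsilon>)))" for n
  proof -
    obtain F where F: "finite F" "{x. (left_hit t ^^ n) x = 0} \<subseteq> span F"
      using kernel_t_power_finite by blast
    have "\<exists>g\<in>dual. f = conv g ((conv t ^^ n) \<epsilon>)" if f: "f \<in> dual" "\<forall>x\<in>F. f x = 0" for f
    proof -
      interpret vector_space_pair scale "(*)"
        using vector_space_axioms by (simp add: vector_space_pair_def vector_space_def algebra_simps)
      have "f x = 0" if "x \<in> span F" for x
        using linear_eq_0_on_span[of f F x] f that by (auto simp: dual_def)
      then show ?thesis using right_multiple_iff[OF power(1) f(1)] F(2) by (auto simp: power(2))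
    qed
    then show ?thesis using F(1) by blast
  qed
  show "\<exists>n. \<forall>g\<in>dual. conv g ((conv t ^^ n) \<epsilon>) c = 0" for c
  proof -
    obtain n where "(left_hit t ^^ n) c = 0" using left_hit_t_locally_nilpotent by blast
    then show ?thesis by (intro exI[of _ n]) (simp add: conv_left_hit power(2) dual_0)
  qed
qed (fact t_dual)

lemma (in chain_coalgebra) exists_uniformized: "\<exists>t. uniformized_coalgebra scale \<Delta> \<epsilon> t"
  using exists_socle chain_socle.exists_uniformizer chain_uniformizer.uniformized by blast

section \<open>Modules over a uniformized dual algebra\<close>

context coalgebra
begin

context
  fixes act :: "('c \<Rightarrow> 'k) \<Rightarrow> 'm::ab_group_add \<Rightarrow> 'm"
  assumes act: "left_module act"
begin

lemma
  shows act_add: "f \<in> dual \<Longrightarrow> act f (m + n) = act f m + act f n"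
    and act_plus: "f \<in> dual \<Longrightarrow> g \<in> dual \<Longrightarrow> act (\<lambda>c. f c + g c) m = act f m + act g m"
    and act_conv: "f \<in> dual \<Longrightarrow> g \<in> dual \<Longrightarrow> act (conv f g) m = act f (act g m)"
    and act_counit: "act \<epsilon> m = m"
  using act by (simp_all add: left_module_def)

lemma act_zero: "f \<in> dual \<Longrightarrow> act f 0 = 0"
  using act_add[of f 0 0] by simp

lemma act_zero_left: "act (\<lambda>c. 0) m = 0"
  using act_plus[of "\<lambda>c. 0" "\<lambda>c. 0" m] by simp

lemma act_minus_left: "f \<in> dual \<Longrightarrow> g \<in> dual \<Longrightarrow> act (\<lambda>c. f c - g c) m = act f m - act g m"
  using act_plus[of "\<lambda>c. f c - g c" g m] by simp

lemma act_sum: "f \<in> dual \<Longrightarrow> act f (\<Sum>s\<in>A. g s) = (\<Sum>s\<in>A. act f (g s))"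
  by (induction A rule: infinite_finite_induct) (simp_all add: act_zero act_add)

lemma act_sum_list_left:
  "(\<And>x. x \<in> set xs \<Longrightarrow> f x \<in> dual) \<Longrightarrow> act (\<lambda>c. \<Sum>x\<leftarrow>xs. f x c) m = (\<Sum>x\<leftarrow>xs. act (f x) m)"
  by (induction xs) (simp_all add: act_zero_left act_plus)

lemma module_scale_act: "f \<in> dual \<Longrightarrow> module_scale act k (act f m) = act (\<lambda>c. k * f c) m"
  using act_conv[of "\<lambda>c. k * \<epsilon> c" f m] by (simp add: module_scale_def conv_scale_left)

lemma act_module_scale: "f \<in> dual \<Longrightarrow> act f (module_scale act k m) = module_scale act k (act f m)"
  using act_conv[of f "\<lambda>c. k * \<epsilon> c" m]
  by (subst module_scale_act) (simp_all add: module_scale_def conv_scale_right)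

lemma vector_space_module_scale: "vector_space (module_scale act)"
proof
  show "module_scale act a (x + y) = module_scale act a x + module_scale act a y" for a x y
    by (simp add: module_scale_def act_add)
  show "module_scale act (a + b) x = module_scale act a x + module_scale act b x" for a b x
    by (simp add: module_scale_def act_plus[symmetric] distrib_right)
  show "module_scale act a (module_scale act b x) = module_scale act (a * b) x" for a b x
    using module_scale_act[of "\<lambda>c. b * \<epsilon> c" a x] by (simp add: module_scale_def mult.assoc)
  show "module_scale act 1 x = x" for x
    by (simp add: module_scale_def act_counit)
qed

lemma submodule_sum_list: "submodule act N \<Longrightarrow> set ms \<subseteq> N \<Longrightarrow> sum_list ms \<in> N"
  by (induction ms) (simp_all add: submodule_def)

lemma submodule_subspace: "submodule act N \<Longrightarrow> module.subspace (module_scale act) N"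
  using vector_space_module_scale
  by (auto simp: module.subspace_def module_iff_vector_space submodule_def module_scale_def)

text \<open>
  The coaction is \<open>m \<mapsto> \<Sum> (e b \<cdot> m) \<otimes> b\<close>, summed over \<open>bs\<close>. By
  hypothesis, applying a functional \<open>f\<close> to its second factor gives \<open>f \<cdot> m\<close>. Since
  functionals separate tensors, the comodule axioms reduce to the module axioms; coassociativity becomes
  \<open>f \<cdot> (g \<cdot> m) = (f g) \<cdot> m\<close>.
\<close>

lemma left_rational_if_finite_coordinates:
  assumes N: "submodule act N" and e: "\<And>b. e b \<in> dual"
    and coord: "\<And>f m. f \<in> dual \<Longrightarrow> m \<in> N \<Longrightarrow> act f m = (\<Sum>b\<leftarrow>bs. module_scale act (f b) (act (e b) m))"
  shows "left_rational act N"
proof -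
  let ?s = "module_scale act"
  interpret s: vector_space ?s by (rule vector_space_module_scale)
  have sub: "s.subspace N" by (rule submodule_subspace[OF N])
  define \<rho> where "\<rho> m = map (\<lambda>b. (act (e b) m, b)) bs" for m
  have \<rho>: "set (\<rho> m) \<subseteq> N \<times> UNIV" if "m \<in> N" for m
    using that N e by (auto simp: \<rho>_def submodule_def)
  have eval: "(\<Sum>(m, c)\<leftarrow>\<rho> n. ?s (f c) m) = act f n" if "f \<in> dual" "n \<in> N" for f n
    using coord[OF that] by (simp add: \<rho>_def o_def)
  have right_comodule: "right_comodule ?s N \<rho>"
    unfolding right_comodule_def
  proof (intro conjI ballI allI)
    show "tensor_eq ?s scale N UNIV (\<rho> (m + n)) (\<rho> m @ \<rho> n)" if "m \<in> N" "n \<in> N" for m n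
    proof (rule tensor_eq_if_functionals_eq)
      have "m + n \<in> N" using that N by (simp add: submodule_def)
      show "(\<Sum>(a, b)\<leftarrow>\<rho> (m + n). ?s (f b) a) = (\<Sum>(a, b)\<leftarrow>\<rho> m @ \<rho> n. ?s (f b) a)"
        if "Vector_Spaces.linear scale (*) f" for f
      proof -
        have "f \<in> dual" using that by (simp add: dual_def)
        then show ?thesis using \<open>m + n \<in> N\<close> \<open>m \<in> N\<close> \<open>n \<in> N\<close> by (simp add: eval act_add)
      qed
      show "set (\<rho> (m + n)) \<subseteq> N \<times> UNIV" using \<open>m + n \<in> N\<close> by (rule \<rho>)
    qed (use that \<rho> sub s.vector_space_axioms vector_space_axioms in auto)
    show "tensor_eq ?s scale N UNIV (\<rho> (?s k n)) [(?s k m, c). (m, c) \<leftarrow> \<rho> n]" if n: "n \<in> N" for k n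
    proof -
      have "\<rho> (?s k n) = [(?s k m, c). (m, c) \<leftarrow> \<rho> n]"
        by (simp add: \<rho>_def act_module_scale e)
      moreover have "?s k n \<in> N" using n sub by (rule s.subspace_scale[rotated])
      ultimately show ?thesis using \<rho> tensor_eq.refl by metis
    qed
    show "tensor3_eq ?s scale scale N UNIV UNIV
        [(p, q, c). (m, c) \<leftarrow> \<rho> n, (p, q) \<leftarrow> \<rho> m] [(m, p, q). (m, c) \<leftarrow> \<rho> n, (p, q) \<leftarrow> \<Delta> c]"
      if n: "n \<in> N" for n
    proof (rule tensor3_eq_if_functionals_eq)
      fix f g assume "Vector_Spaces.linear scale (*) f" "Vector_Spaces.linear scale (*) g"
      then have f: "f \<in> dual" and g: "g \<in> dual" by (simp_all add: dual_def)
      have "(\<Sum>(a, b, c)\<leftarrow>[(p, q, c). (m, c) \<leftarrow> \<rho> n, (p, q) \<leftarrow> \<rho> m]. ?s (f b * g c) a) =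
          (\<Sum>(m, c)\<leftarrow>\<rho> n. ?s (g c) (\<Sum>(p, q)\<leftarrow>\<rho> m. ?s (f q) p))"
        by (simp add: sum_list_concat_map case_prod_unfold o_def mult.commute
          vector_space.scale_sum_list[OF s.vector_space_axioms])
      also have "\<dots> = (\<Sum>(m, c)\<leftarrow>\<rho> n. ?s (g c) (act f m))"
        using eval[OF f] \<rho>[OF n] by (intro arg_cong[of _ _ sum_list] map_cong) auto
      also have "\<dots> = act f (\<Sum>(m, c)\<leftarrow>\<rho> n. ?s (g c) m)"
      proof -
        have "act f (\<Sum>(m, c)\<leftarrow>xs. ?s (g c) m) = (\<Sum>(m, c)\<leftarrow>xs. ?s (g c) (act f m))" for xs
          by (induction xs) (auto simp: act_zero[OF f] act_add[OF f] act_module_scale[OF f])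
        then show ?thesis by simp
      qed
      also have "\<dots> = act (conv f g) n"
        using f g n by (simp add: eval act_conv)
      also have "\<dots> = (\<Sum>(m, c)\<leftarrow>\<rho> n. ?s (conv f g c) m)"
        using f g n by (simp add: eval)
      also have "\<dots> = (\<Sum>(a, b, c)\<leftarrow>[(m, p, q). (m, c) \<leftarrow> \<rho> n, (p, q) \<leftarrow> \<Delta> c]. ?s (f b * g c) a)"
        by (simp add: sum_list_concat_map case_prod_unfold o_def conv_def
          vector_space.sum_list_scale[OF s.vector_space_axioms])
      finally show "(\<Sum>(a, b, c)\<leftarrow>[(p, q, c). (m, c) \<leftarrow> \<rho> n, (p, q) \<leftarrow> \<rho> m]. ?s (f b * g c) a) =
        (\<Sum>(a, b, c)\<leftarrow>[(m, p, q). (m, c) \<leftarrow> \<rho> n, (p, q) \<leftarrow> \<Delta> c]. ?s (f b * g c) a)" .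
    next
      show "set [(p, q, c). (m, c) \<leftarrow> \<rho> n, (p, q) \<leftarrow> \<rho> m] \<subseteq> N \<times> UNIV"
        using \<rho>[OF n] \<rho> by fastforce
      show "set [(m, p, q). (m, c) \<leftarrow> \<rho> n, (p, q) \<leftarrow> \<Delta> c] \<subseteq> N \<times> UNIV"
        using \<rho>[OF n] by fastforce
    qed (fact s.vector_space_axioms vector_space_axioms sub)+
    show "(\<Sum>(m, c)\<leftarrow>\<rho> n. ?s (\<epsilon> c) m) = n" if "n \<in> N" for n
      using that by (simp add: eval act_counit)
  qed (use \<rho> sub s.vector_space_axioms in auto)
  show ?thesis
    unfolding left_rational_def using N right_comodule eval by metis
qed

end

end

context uniformized_coalgebra
begin

abbreviation t_power :: "nat \<Rightarrow> 'c \<Rightarrow> 'k" where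
  "t_power n \<equiv> (conv t ^^ n) \<epsilon>"

lemma t_power_dual [simp]: "t_power n \<in> dual"
  by (induction n) simp_all

lemma t_power_add: "t_power (m + n) = conv (t_power m) (t_power n)"
  by (induction m) (simp_all add: conv_assoc)

lemma t_power_Suc_right: "t_power (Suc n) = conv (t_power n) t"
  using t_power_add[of n 1] by simp

lemma t_power_left_multiple:
  assumes "f \<in> dual"
  shows "\<exists>g\<in>dual. conv (t_power n) f = conv g (t_power n)"
  using assms
proof (induction n arbitrary: f)
  case 0
  then show ?case by auto
next
  case (Suc n)
  obtain g where g: "g \<in> dual" "conv t f = conv g t"
    using t_normal[of "conv t f"] Suc.prems by auto
  obtain h where h: "h \<in> dual" "conv (t_power n) g = conv h (t_power n)"
    using Suc.IH[OF g(1)] by blast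
  have "conv (t_power (Suc n)) f = conv (t_power n) (conv t f)"
    using Suc.prems unfolding t_power_Suc_right by (simp add: conv_assoc)
  also have "\<dots> = conv (conv (t_power n) g) t"
    using g by (simp add: conv_assoc)
  also have "\<dots> = conv h (t_power (Suc n))"
    using h unfolding t_power_Suc_right by (simp add: conv_assoc)
  finally show ?case using h(1) by blast
qed

lemma t_power_right_multiple:
  assumes "f \<in> dual"
  shows "\<exists>g\<in>dual. conv f (t_power n) = conv (t_power n) g"
  using assms
proof (induction n arbitrary: f)
  case 0
  then show ?case by auto
next
  case (Suc n)
  obtain g where g: "g \<in> dual" "conv f t = conv t g"
    using t_normal[of "conv f t"] Suc.prems by auto
  obtain h where h: "h \<in> dual" "conv g (t_power n) = conv (t_power n) h"
    using Suc.IH[OF g(1)] by blast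
  have "conv f (t_power (Suc n)) = conv (conv f t) (t_power n)"
    using Suc.prems by (simp add: conv_assoc)
  also have "\<dots> = conv t (conv g (t_power n))"
    using g by (simp add: conv_assoc)
  also have "\<dots> = conv (t_power (Suc n)) h"
    using h by (simp add: conv_assoc)
  finally show ?case using h(1) by blast
qed

text \<open>
  Cancel the highest power of \<open>t\<close> that divides all the given functionals, which exists because
  \<open>r a \<noteq> 0\<close> is not divisible by all powers. What remains is not divisible by \<open>t\<close> at
  every place, so it contains a unit.
\<close>

lemma common_power_factor:
  assumes r: "\<And>s. s \<in> A \<Longrightarrow> r s \<in> dual" and nz: "a \<in> A" "r a \<noteq> (\<lambda>c. 0)"
  shows "\<exists>k g. (\<forall>s\<in>A. g s \<in> dual \<and> r s = conv (t_power k) (g s)) \<and>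
    (\<exists>s\<in>A. \<exists>u\<in>dual. conv u (g s) = \<epsilon>)"
proof -
  define P where "P k \<longleftrightarrow> (\<forall>s\<in>A. \<exists>g\<in>dual. r s = conv (t_power k) g)" for k
  obtain c where c: "r a c \<noteq> 0" using nz(2) by blast
  obtain n where n: "\<And>g. g \<in> dual \<Longrightarrow> conv g (t_power n) c = 0" using separated by blast
  have "P 0" unfolding P_def using r by (auto intro!: bexI)
  moreover have "\<not> P n"
  proof
    assume "P n"
    then obtain g where "g \<in> dual" "r a = conv (t_power n) g" using nz(1) by (auto simp: P_def)
    then show False using t_power_left_multiple[of g n] n c by auto
  qed
  ultimately obtain k where k: "P k" "\<not> P (Suc k)"
    using nat_induct[of P n] by blast
  obtain g where g: "\<forall>s\<in>A. g s \<in> dual \<and> r s = conv (t_power k) (g s)"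
    using k(1) unfolding P_def by metis
  have "\<exists>s\<in>A. \<not> (\<exists>h\<in>dual. g s = conv t h)"
  proof (rule ccontr)
    assume "\<not> ?thesis"
    then have "\<exists>h\<in>dual. r s = conv (t_power (Suc k)) h" if "s \<in> A" for s
      using that g unfolding t_power_Suc_right by (metis conv_assoc t_power_dual t_dual)
    then show False using k(2) by (auto simp: P_def)
  qed
  then show ?thesis using g unit_or_multiple by metis
qed

context
  fixes act :: "('c \<Rightarrow> 'k) \<Rightarrow> 'm::ab_group_add \<Rightarrow> 'm"
  assumes act: "left_module act"
begin

lemma t_power_kernel_submodule: "submodule act {m. act (t_power n) m = 0}"
  unfolding submodule_def mem_Collect_eq
proof (intro conjI ballI)
  show "act (t_power n) 0 = 0" by (simp add: act_zero[OF act])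
  show "act (t_power n) (l + m) = 0"
    if "l \<in> {m. act (t_power n) m = 0}" "m \<in> {m. act (t_power n) m = 0}" for l m
    using that by (simp add: act_add[OF act])
  show "act (t_power n) (act f m) = 0" if f: "f \<in> dual" and m: "m \<in> {m. act (t_power n) m = 0}" for f m
  proof -
    obtain g where "g \<in> dual" "conv (t_power n) f = conv g (t_power n)"
      using t_power_left_multiple[OF f] by blast
    then have "act (t_power n) (act f m) = act g (act (t_power n) m)"
      using f by (metis act_conv[OF act] t_power_dual)
    then show ?thesis using m \<open>g \<in> dual\<close> by (simp add: act_zero[OF act])
  qed
qed

lemma t_power_kernel_mono: "act (t_power n) m = 0 \<Longrightarrow> act (t_power (k + n)) m = 0"
  by (simp add: t_power_add act_conv[OF act] act_zero[OF act])

text \<open>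
  Choose a finite set \<open>F\<close> such that functionals vanishing on \<open>F\<close> are multiples of
  \<open>t\<^sup>n\<close>, and hence act as zero. Modulo such functionals, every \<open>f\<close> is the combination
  of the coordinate functionals of \<open>span F\<close> with coefficients the values of \<open>f\<close> on the
  basis.
\<close>

lemma left_rational_t_power_kernel: "left_rational act {m. act (t_power n) m = 0}"
proof -
  obtain F where F: "finite F"
    "\<And>f. f \<in> dual \<Longrightarrow> \<forall>x\<in>F. f x = 0 \<Longrightarrow> \<exists>g\<in>dual. f = conv g (t_power n)"
    using finite_codim[of n] by blast
  obtain bs e where e: "\<And>b. e b \<in> dual" "\<And>x. x \<in> span F \<Longrightarrow> x = (\<Sum>b\<leftarrow>bs. scale (e b x) b)"
    using finite_coordinates[OF F(1)] unfolding dual_def mem_Collect_eq by blast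
  show ?thesis
  proof (rule left_rational_if_finite_coordinates[OF act t_power_kernel_submodule e(1), where bs = bs])
    fix f m assume f: "f \<in> dual" and m: "m \<in> {m. act (t_power n) m = 0}"
    define f' where "f' = (\<lambda>c. \<Sum>b\<leftarrow>bs. f b * e b c)"
    have f': "f' \<in> dual" unfolding f'_def using e(1) by simp
    have "f x = f' x" if "x \<in> F" for x
    proof -
      have "f x = f (\<Sum>b\<leftarrow>bs. scale (e b x) b)" using e(2) span_base[OF that] by metis
      then show ?thesis by (simp add: dual_sum_list[OF f] dual_scale[OF f] f'_def mult.commute)
    qed
    then obtain g where g: "g \<in> dual" "(\<lambda>c. f c - f' c) = conv g (t_power n)"
      using F(2)[of "\<lambda>c. f c - f' c"] f f' by auto
    have "act f m - act f' m = act (conv g (t_power n)) m"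
      using act_minus_left[OF act f f'] g(2) by simp
    also have "\<dots> = 0" using m g(1) by (simp add: act_conv[OF act] act_zero[OF act])
    finally have "act f m = act f' m" by simp
    also have "\<dots> = (\<Sum>b\<leftarrow>bs. act (\<lambda>c. f b * e b c) m)"
      unfolding f'_def using e(1) by (intro act_sum_list_left[OF act]) simp
    also have "\<dots> = (\<Sum>b\<leftarrow>bs. module_scale act (f b) (act (e b) m))"
      using e(1) by (simp add: module_scale_act[OF act])
    finally show "act f m = \<dots>" .
  qed
qed

lemma torsion_submodule: "submodule act {m. \<exists>n. act (t_power n) m = 0}"
  unfolding submodule_def mem_Collect_eq
proof (intro conjI ballI)
  show "\<exists>n. act (t_power n) 0 = 0" by (simp add: act_zero[OF act])
  show "\<exists>n. act (t_power n) (l + m) = 0"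
    if lm: "l \<in> {m. \<exists>n. act (t_power n) m = 0}" "m \<in> {m. \<exists>n. act (t_power n) m = 0}" for l m
  proof -
    obtain i j where "act (t_power i) l = 0" "act (t_power j) m = 0" using lm by blast
    then have "act (t_power (i + j)) (l + m) = 0"
      using t_power_kernel_mono[of i l j] t_power_kernel_mono[of j m i]
      by (simp add: act_add[OF act] add.commute[of j i])
    then show ?thesis by blast
  qed
  show "\<exists>n. act (t_power n) (act f m) = 0"
    if f: "f \<in> dual" and m: "m \<in> {m. \<exists>n. act (t_power n) m = 0}" for f m
  proof -
    obtain n where "m \<in> {m. act (t_power n) m = 0}" using m by blast
    then have "act f m \<in> {m. act (t_power n) m = 0}"
      using f t_power_kernel_submodule[of n] unfolding submodule_def by blast
    then show ?thesis by blast
  qed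
qed

text \<open>
  If \<open>m\<close> is rational, \<open>t\<^sup>n \<cdot> m\<close> is the combination of finitely many vectors with
  coefficients \<open>t\<^sup>n(c)\<close>, and these vanish for large \<open>n\<close>. Conversely a torsion element
  lies in one of the rational submodules \<open>{m. t\<^sup>n m = 0}\<close>.
\<close>

lemma left_Rat_eq_torsion: "left_Rat act = {m. \<exists>n. act (t_power n) m = 0}"
proof
  have "m \<in> {m. \<exists>n. act (t_power n) m = 0}" if N: "left_rational act N" and m: "m \<in> N" for N m
  proof -
    interpret s: vector_space "module_scale act" by (rule vector_space_module_scale[OF act])
    obtain \<rho> where \<rho>: "\<And>f n. f \<in> dual \<Longrightarrow> n \<in> N \<Longrightarrow> act f n = (\<Sum>(m, c)\<leftarrow>\<rho> n. module_scale act (f c) m)"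
      using N unfolding left_rational_def by blast
    \<comment> \<open>One exponent for all \<open>c\<close> in a finite list; the factor \<open>g\<close> keeps the property when \<open>n\<close> grows.\<close>
    have "\<exists>n. \<forall>c\<in>set cs. \<forall>g\<in>dual. conv g (t_power n) c = 0" for cs
    proof (induction cs)
      case (Cons c cs)
      then obtain i where i: "\<forall>c\<in>set cs. \<forall>g\<in>dual. conv g (t_power i) c = 0" by blast
      obtain j where j: "\<forall>g\<in>dual. conv g (t_power j) c = 0" using separated by blast
      have "conv g (t_power (j + i)) d = 0" if "g \<in> dual" "d \<in> set (c # cs)" for g d
      proof (cases "d = c")
        case True
        have "conv g (t_power (i + j)) c = 0"
          using j that(1) unfolding t_power_add by (simp add: conv_assoc[symmetric])
        then show ?thesis using True by (simp add: add.commute)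
      next
        case False
        then show ?thesis
          using i that unfolding t_power_add by (simp add: conv_assoc[symmetric])
      qed
      then show ?case by blast
    qed simp
    then obtain n where n: "\<forall>c\<in>set (map snd (\<rho> m)). \<forall>g\<in>dual. conv g (t_power n) c = 0" by blast
    have zero: "t_power n c = 0" if "(a, c) \<in> set (\<rho> m)" for a c
    proof -
      have "c \<in> set (map snd (\<rho> m))" using that by force
      then have "conv \<epsilon> (t_power n) c = 0" using n counit_dual by blast
      then show ?thesis by simp
    qed
    have "act (t_power n) m = (\<Sum>(m, c)\<leftarrow>\<rho> m. module_scale act (t_power n c) m)"
      by (rule \<rho>[OF t_power_dual m])
    also have "\<dots> = (\<Sum>x\<leftarrow>\<rho> m. 0)"
      by (intro arg_cong[of _ _ sum_list] map_cong) (auto dest: zero)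
    finally show ?thesis by auto
  qed
  then show "left_Rat act \<subseteq> {m. \<exists>n. act (t_power n) m = 0}"
    using submodule_sum_list[OF act torsion_submodule] by (fastforce simp: left_Rat_def)
  show "{m. \<exists>n. act (t_power n) m = 0} \<subseteq> left_Rat act"
  proof
    fix m assume "m \<in> {m. \<exists>n. act (t_power n) m = 0}"
    then obtain n where "m \<in> {m. act (t_power n) m = 0}" by blast
    then have "m = sum_list [m] \<and> set [m] \<subseteq> \<Union> {N. left_rational act N}"
      using left_rational_t_power_kernel by auto
    then show "m \<in> left_Rat act" unfolding left_Rat_def by blast
  qed
qed

text \<open>
  The complement is spanned by a set \<open>A\<close> that generates the module modulo torsion and has the least
  cardinality. In a nontrivial relation modulo torsion among the elements of \<open>A\<close>, the common power of
  \<open>t\<close> can be cancelled, since an element with torsion multiple \<open>t\<^sup>k m\<close> is torsion.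
  Some coefficient is then a unit, and the corresponding generator can be eliminated, contrary to minimality.
\<close>

lemma torsion_direct_summand:
  assumes "finitely_generated act"
  shows "direct_summand act {m. \<exists>n. act (t_power n) m = 0}"
proof -
  define T where "T = {m. \<exists>n. act (t_power n) m = 0}"
  have T: "submodule act T" unfolding T_def by (rule torsion_submodule)
  define gen where "gen A \<longleftrightarrow> finite A \<and>
    (\<forall>m. \<exists>r. (\<forall>s\<in>A. r s \<in> dual) \<and> m - (\<Sum>s\<in>A. act (r s) s) \<in> T)" for A
  have "\<exists>A. gen A"
  proof -
    obtain A where A: "finite A" "\<And>m. \<exists>r. (\<forall>s\<in>A. r s \<in> dual) \<and> m = (\<Sum>s\<in>A. act (r s) s)"
      using assms unfolding finitely_generated_def by blast
    have "\<exists>r. (\<forall>s\<in>A. r s \<in> dual) \<and> m - (\<Sum>s\<in>A. act (r s) s) \<in> T" for m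
      using A(2)[of m] T by (auto simp: submodule_def)
    then show ?thesis using A(1) unfolding gen_def by blast
  qed
  then obtain A where A: "gen A" "\<And>B. gen B \<Longrightarrow> card A \<le> card B"
    using ex_has_least_nat[of gen _ card] by blast
  have fin: "finite A" using A(1) by (simp add: gen_def)
  have indep: "r s = (\<lambda>c. 0)"
    if r: "\<And>s. s \<in> A \<Longrightarrow> r s \<in> dual" and rT: "(\<Sum>s\<in>A. act (r s) s) \<in> T" and s: "s \<in> A" for r s
  proof (rule ccontr)
    assume "r s \<noteq> (\<lambda>c. 0)"
    then obtain k g a u where g: "\<And>s. s \<in> A \<Longrightarrow> g s \<in> dual" "\<And>s. s \<in> A \<Longrightarrow> r s = conv (t_power k) (g s)"
      and a: "a \<in> A" "u \<in> dual" "conv u (g a) = \<epsilon>"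
      using common_power_factor[of A r s, OF r s] by blast
    have "(\<Sum>s\<in>A. act (r s) s) = act (t_power k) (\<Sum>s\<in>A. act (g s) s)"
      using g by (simp add: act_sum[OF act] act_conv[OF act])
    then obtain n where "act (t_power n) (act (t_power k) (\<Sum>s\<in>A. act (g s) s)) = 0"
      using rT by (auto simp: T_def)
    then have "(\<Sum>s\<in>A. act (g s) s) \<in> T"
      unfolding T_def by (auto simp: act_conv[OF act, symmetric] t_power_add[symmetric])
    then have "act u (\<Sum>s\<in>A. act (g s) s) \<in> T" using T a(2) by (simp add: submodule_def)
    also have "act u (\<Sum>s\<in>A. act (g s) s) = (\<Sum>s\<in>A. act (conv u (g s)) s)"
      using g(1) a(2) by (simp add: act_sum[OF act] act_conv[OF act])
    also have "\<dots> = a + (\<Sum>s\<in>A - {a}. act (conv u (g s)) s)"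
      using fin a by (simp add: sum.remove[of A a] act_counit[OF act])
    finally have aT: "a + (\<Sum>s\<in>A - {a}. act (conv u (g s)) s) \<in> T" .
    have "\<exists>q. (\<forall>s\<in>A - {a}. q s \<in> dual) \<and> m - (\<Sum>s\<in>A - {a}. act (q s) s) \<in> T" for m
    proof -
      obtain p where p: "\<And>s. s \<in> A \<Longrightarrow> p s \<in> dual" "m - (\<Sum>s\<in>A. act (p s) s) \<in> T"
        using A(1) unfolding gen_def by blast
      \<comment> \<open>Substitute for \<open>a\<close>, using that \<open>a\<close> is minus the sum of the \<open>u g(s) \<cdot> s\<close> modulo torsion.\<close>
      define q where "q s = (\<lambda>c. p s c - conv (p a) (conv u (g s)) c)" for s
      have q: "q s \<in> dual" if "s \<in> A" for s
        using that a p(1) g(1) by (simp add: q_def)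
      have "(\<Sum>s\<in>A - {a}. act (q s) s) =
          (\<Sum>s\<in>A - {a}. act (p s) s) - act (p a) (\<Sum>s\<in>A - {a}. act (conv u (g s)) s)"
        using a p(1) g(1)
        by (simp add: q_def act_minus_left[OF act] act_conv[OF act] act_sum[OF act] sum_subtractf)
      then have eq: "m - (\<Sum>s\<in>A - {a}. act (q s) s) = (m - (\<Sum>s\<in>A. act (p s) s)) +
          act (p a) (a + (\<Sum>s\<in>A - {a}. act (conv u (g s)) s))"
        using fin a(1) p(1) by (simp add: sum.remove[of A a] act_add[OF act] algebra_simps)
      have "m - (\<Sum>s\<in>A - {a}. act (q s) s) \<in> T"
        unfolding eq using p a(1) aT T by (simp add: submodule_def)
      then show ?thesis using q by blast
    qed
    then have "gen (A - {a})" using fin by (simp add: gen_def)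
    then show False using A(2) card_Diff1_less[OF fin a(1)] by fastforce
  qed
  define Q where "Q = {\<Sum>s\<in>A. act (r s) s |r. \<forall>s\<in>A. r s \<in> dual}"
  have "submodule act Q"
    unfolding submodule_def
  proof (intro conjI ballI)
    show "0 \<in> Q"
      unfolding Q_def by (auto intro!: exI[of _ "\<lambda>s c. 0"] simp: act_zero_left[OF act])
    show "m + n \<in> Q" if mn: "m \<in> Q" "n \<in> Q" for m n
    proof -
      obtain p q where p: "\<And>s. s \<in> A \<Longrightarrow> p s \<in> dual" "m = (\<Sum>s\<in>A. act (p s) s)"
        and q: "\<And>s. s \<in> A \<Longrightarrow> q s \<in> dual" "n = (\<Sum>s\<in>A. act (q s) s)"
        using mn unfolding Q_def by blast
      have "m + n = (\<Sum>s\<in>A. act (\<lambda>c. p s c + q s c) s)"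
        using p q by (simp add: act_plus[OF act] sum.distrib)
      then show ?thesis unfolding Q_def using p(1) q(1) by (auto intro!: exI[of _ "\<lambda>s c. p s c + q s c"])
    qed
    show "act f m \<in> Q" if f: "f \<in> dual" and m: "m \<in> Q" for f m
    proof -
      obtain p where p: "\<And>s. s \<in> A \<Longrightarrow> p s \<in> dual" "m = (\<Sum>s\<in>A. act (p s) s)"
        using m unfolding Q_def by blast
      have "act f m = (\<Sum>s\<in>A. act (conv f (p s)) s)"
        using p f by (simp add: act_conv[OF act] act_sum[OF act])
      then show ?thesis unfolding Q_def using p(1) f by (auto intro!: exI[of _ "\<lambda>s. conv f (p s)"])
    qed
  qed
  moreover have "T \<inter> Q = {0}"
  proof -
    have "m = 0" if m: "m \<in> T" "m \<in> Q" for m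
    proof -
      obtain r where r: "\<And>s. s \<in> A \<Longrightarrow> r s \<in> dual" "m = (\<Sum>s\<in>A. act (r s) s)"
        using m(2) unfolding Q_def by blast
      then have "r s = (\<lambda>c. 0)" if "s \<in> A" for s using indep[of r s] m(1) that by blast
      then show ?thesis using r(2) by (simp add: act_zero_left[OF act])
    qed
    then show ?thesis using T \<open>submodule act Q\<close> by (auto simp: submodule_def)
  qed
  moreover have "\<exists>p\<in>T. \<exists>q\<in>Q. m = p + q" for m
  proof -
    obtain r where r: "\<forall>s\<in>A. r s \<in> dual" "m - (\<Sum>s\<in>A. act (r s) s) \<in> T"
      using A(1) unfolding gen_def by blast
    moreover have "(\<Sum>s\<in>A. act (r s) s) \<in> Q" using r(1) unfolding Q_def by blast
    ultimately show ?thesis by (metis diff_add_cancel)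
  qed
  ultimately show ?thesis unfolding direct_summand_def T_def[symmetric] using T by blast
qed

end

lemma left_splitting: "left_finite_Rat_splitting TYPE('m::ab_group_add)"
  unfolding left_finite_Rat_splitting_def
  using torsion_direct_summand left_Rat_eq_torsion by metis

end

section \<open>The coopposite coalgebra\<close>

lemma tensor3_eq_sym_iff:
  "tensor3_eq sa sb sc A B C xs ys \<longleftrightarrow> tensor3_eq sa sb sc A B C ys xs"
  by (rule iffI; erule tensor3_eq.sym)

context coalgebra
begin

text \<open>
  Passing to the coopposite coalgebra reverses the multiplication of the dual algebra and interchanges
  left and right comodules.
\<close>

abbreviation (input) cop :: "'c \<Rightarrow> ('c \<times> 'c) list" where
  "cop \<equiv> \<lambda>c. map prod.swap (\<Delta> c)"

lemma coalgebra_cop: "coalgebra scale cop \<epsilon>"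
proof (intro coalgebra.intro coalgebra_axioms.intro vector_space_axioms)
  note vs = vector_space_axioms
  show "tensor_eq scale scale UNIV UNIV (cop (x + y)) (cop x @ cop y)" for x y
    using tensor_eq_swap[OF comult_add vs vs] by simp
  show "tensor_eq scale scale UNIV UNIV (cop (scale k x)) [(scale k a, b). (a, b) \<leftarrow> cop x]" for k x
  proof -
    have "tensor_eq scale scale UNIV UNIV (cop (scale k x)) (map (\<lambda>(a, b). (b, scale k a)) (\<Delta> x))"
      using tensor_eq_swap[OF comult_scale vs vs, of k x] by (simp add: case_prod_unfold o_def)
    moreover have "tensor_eq scale scale UNIV UNIV (map (\<lambda>(a, b). (b, scale k a)) xs)
        (map (\<lambda>(a, b). (scale k b, a)) xs)" for xs
    proof (induction xs)
      case Nil
      then show ?case by (simp add: tensor_eq.refl)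
    next
      case (Cons x xs)
      obtain a b where x: "x = (a, b)" by (cases x)
      have "tensor_eq scale scale UNIV UNIV [(b, scale k a)] [(scale k b, a)]"
        by (rule tensor_eq.sym, rule tensor_eq.scale) auto
      then show ?case using tensor_eq.append[OF _ Cons.IH] x by fastforce
    qed
    ultimately have "tensor_eq scale scale UNIV UNIV (cop (scale k x)) (map (\<lambda>(a, b). (scale k b, a)) (\<Delta> x))"
      by (rule tensor_eq.trans)
    then show ?thesis by (simp add: case_prod_unfold o_def)
  qed
  show "tensor3_eq scale scale scale UNIV UNIV UNIV
      [(p, q, b). (a, b) \<leftarrow> cop x, (p, q) \<leftarrow> cop a] [(a, p, q). (a, b) \<leftarrow> cop x, (p, q) \<leftarrow> cop b]" for x
    using tensor3_eq.sym[OF tensor3_eq_swap[OF coassoc[of x] vs vs vs UNIV_I UNIV_I]]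
    by (simp add: map_concat o_def case_prod_unfold swap3_def prod.swap_def)
  show "Vector_Spaces.linear scale (*) \<epsilon>" by (rule counit_linear)
  show "(\<Sum>(a, b)\<leftarrow>cop x. scale (\<epsilon> a) b) = x" for x
    using counit_right[of x] by (simp add: o_def case_prod_unfold)
  show "(\<Sum>(a, b)\<leftarrow>cop x. scale (\<epsilon> b) a) = x" for x
    using counit_left[of x] by (simp add: o_def case_prod_unfold)
qed

lemma conv_cop: "coalgebra.conv cop f g = conv g f"
  unfolding coalgebra.conv_def[OF coalgebra_cop] conv_def
  by (simp add: fun_eq_iff o_def case_prod_unfold mult.commute)

lemma right_module_cop: "coalgebra.left_module scale cop \<epsilon> act \<longleftrightarrow> right_module act"
  unfolding coalgebra.left_module_def[OF coalgebra_cop] right_module_def conv_cop by blast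

text \<open>
  Reversing all tensor factors turns each axiom of one kind of comodule into the same axiom of the
  other kind. The coassociativity axioms also have their two sides interchanged.
\<close>

lemma right_comodule_cop:
  "coalgebra.right_comodule scale cop \<epsilon> s N (\<lambda>n. map prod.swap (\<rho> n)) \<longleftrightarrow> left_comodule s N \<rho>"
proof (cases "vector_space s \<and> module.subspace s N")
  case True
  then have s: "vector_space s" and N: "0 \<in> N"
    by (auto simp: module.subspace_def module_iff_vector_space)
  note vs = vector_space_axioms
  have set: "set (map prod.swap (\<rho> n)) \<subseteq> N \<times> UNIV \<longleftrightarrow> set (\<rho> n) \<subseteq> UNIV \<times> N" for n
    by auto
  have add: "tensor_eq s scale N UNIV (map prod.swap xs) (map prod.swap ys @ map prod.swap zs) \<longleftrightarrow>
      tensor_eq scale s UNIV N xs (ys @ zs)" for xs ys zs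
    using tensor_eq_swap_iff[OF vs s _ N, of UNIV xs "ys @ zs"] by simp
  have scaled: "tensor_eq s scale N UNIV (map prod.swap xs) [(s k m, c). (m, c) \<leftarrow> map prod.swap ys] \<longleftrightarrow>
      tensor_eq scale s UNIV N xs [(c, s k m). (c, m) \<leftarrow> ys]" for k xs ys
    using tensor_eq_swap_iff[OF vs s _ N, of UNIV xs "map (\<lambda>(c, m). (c, s k m)) ys"]
    by (simp add: o_def case_prod_unfold)
  have assoc: "tensor3_eq s scale scale N UNIV UNIV
      [(p, q, c). (m, c) \<leftarrow> map prod.swap xs, (p, q) \<leftarrow> map prod.swap (\<rho> m)]
      [(m, p, q). (m, c) \<leftarrow> map prod.swap xs, (p, q) \<leftarrow> cop c] \<longleftrightarrow>
    tensor3_eq scale scale s UNIV UNIV N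
      [(p, q, m). (c, m) \<leftarrow> xs, (p, q) \<leftarrow> \<Delta> c]
      [(c, p, q). (c, m) \<leftarrow> xs, (p, q) \<leftarrow> \<rho> m]" for xs
    using tensor3_eq_swap_iff[OF vs vs s UNIV_I UNIV_I N, of "[(p, q, m). (c, m) \<leftarrow> xs, (p, q) \<leftarrow> \<Delta> c]"
        "[(c, p, q). (c, m) \<leftarrow> xs, (p, q) \<leftarrow> \<rho> m]"]
    by (subst tensor3_eq_sym_iff) (simp add: map_concat o_def case_prod_unfold swap3_def prod.swap_def)
  have counit: "(\<Sum>(m, c)\<leftarrow>map prod.swap xs. s (\<epsilon> c) m) = (\<Sum>(c, m)\<leftarrow>xs. s (\<epsilon> c) m)" for xs
    by (simp add: o_def case_prod_unfold)
  show ?thesis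
    unfolding coalgebra.right_comodule_def[OF coalgebra_cop] left_comodule_def set add scaled assoc counit
    by (rule HOL.refl)
next
  case False
  then show ?thesis
    unfolding coalgebra.right_comodule_def[OF coalgebra_cop] left_comodule_def by blast
qed

lemma left_rational_cop: "coalgebra.left_rational scale cop \<epsilon> act N \<longleftrightarrow> right_rational act N"
proof -
  let ?P = "\<lambda>\<rho>. left_comodule (module_scale act) N \<rho> \<and>
    (\<forall>f\<in>dual. \<forall>n\<in>N. act f n = (\<Sum>(c, m)\<leftarrow>\<rho> n. module_scale act (f c) m))"
  let ?Q = "\<lambda>\<rho>. coalgebra.right_comodule scale cop \<epsilon> (module_scale act) N \<rho> \<and>
    (\<forall>f\<in>dual. \<forall>n\<in>N. act f n = (\<Sum>(m, c)\<leftarrow>\<rho> n. module_scale act (f c) m))"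
  have PQ: "?Q (\<lambda>n. map prod.swap (\<rho> n)) \<longleftrightarrow> ?P \<rho>" for \<rho>
    unfolding right_comodule_cop by (simp add: o_def case_prod_unfold)
  have "?Q \<rho> \<Longrightarrow> ?P (\<lambda>n. map prod.swap (\<rho> n))" for \<rho>
    using PQ[of "\<lambda>n. map prod.swap (\<rho> n)"] by (simp add: o_def)
  then have "(\<exists>\<rho>. ?Q \<rho>) \<longleftrightarrow> (\<exists>\<rho>. ?P \<rho>)" using PQ by blast
  then show ?thesis
    unfolding coalgebra.left_rational_def[OF coalgebra_cop] right_rational_def by simp
qed

lemma left_Rat_cop: "coalgebra.left_Rat scale cop \<epsilon> act = right_Rat act"
  unfolding coalgebra.left_Rat_def[OF coalgebra_cop] right_Rat_def left_rational_cop ..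

lemma left_splitting_cop:
  "coalgebra.left_finite_Rat_splitting scale cop \<epsilon> TYPE('m::ab_group_add) \<longleftrightarrow>
    right_finite_Rat_splitting TYPE('m)"
  unfolding coalgebra.left_finite_Rat_splitting_def[OF coalgebra_cop] right_finite_Rat_splitting_def
    right_module_cop left_Rat_cop ..

end

lemma (in uniformized_coalgebra) uniformized_cop: "uniformized_coalgebra scale cop \<epsilon> t"
proof -
  have t_power_cop: "((\<lambda>g. conv g t) ^^ n) \<epsilon> = t_power n" for n
    by (induction n) (simp_all add: t_power_Suc_right[simplified])
  show ?thesis
    unfolding uniformized_coalgebra_def uniformized_coalgebra_axioms_def conv_cop t_power_cop
  proof (intro conjI allI impI)
    show "coalgebra scale cop \<epsilon>" by (rule coalgebra_cop)
    fix f assume f: "f \<in> dual"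
    show "(\<exists>g\<in>dual. f = conv g t) \<longleftrightarrow> (\<exists>g\<in>dual. f = conv t g)" using t_normal[OF f] by simp
    show "(\<exists>g\<in>dual. conv g f = \<epsilon> \<and> conv f g = \<epsilon>) \<or> (\<exists>g\<in>dual. f = conv g t)"
      using unit_or_multiple[OF f] t_normal[OF f] by blast
  next
    fix n
    show "\<exists>F. finite F \<and> (\<forall>f\<in>dual. (\<forall>x\<in>F. f x = 0) \<longrightarrow> (\<exists>g\<in>dual. f = conv (t_power n) g))"
      using finite_codim[of n] t_power_right_multiple[of _ n] by metis
  next
    fix c
    obtain n where "\<And>g. g \<in> dual \<Longrightarrow> conv g (t_power n) c = 0" using separated by blast
    then show "\<exists>n. \<forall>g\<in>dual. conv (t_power n) g c = 0" using t_power_left_multiple[of _ n] by metis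
  qed (fact t_dual)
qed

theorem theorem2p7:
  fixes scale :: "'k::field \<Rightarrow> 'c::ab_group_add \<Rightarrow> 'c"
    and \<Delta> :: "'c \<Rightarrow> ('c \<times> 'c) list"
    and \<epsilon> :: "'c \<Rightarrow> 'k"
  assumes "chain_coalgebra scale \<Delta> \<epsilon>"
  shows "coalgebra.left_finite_Rat_splitting scale \<Delta> \<epsilon> TYPE('m::ab_group_add) \<and>
    coalgebra.right_finite_Rat_splitting scale \<Delta> \<epsilon> TYPE('n::ab_group_add)"
proof -
  interpret chain_coalgebra scale \<Delta> \<epsilon> by fact
  obtain t where "uniformized_coalgebra scale \<Delta> \<epsilon> t" using exists_uniformized by blast
  then interpret uniformized_coalgebra scale \<Delta> \<epsilon> t .
  have "right_finite_Rat_splitting TYPE('n)"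
    using uniformized_coalgebra.left_splitting[OF uniformized_cop] left_splitting_cop by blast
  then show ?thesis using left_splitting by blast
qed

end
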